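(* Let $(\Omega,p)$ and $(\Sigma,q)$ be connected coverings of a $k$-graph $\Lambda$. (1) For all $x\in\Lambda^0$, the family $\{p_*\pi(\Omega,v)\mid v\in\Omega^0,\ p(v)=x\}$ is a conjugacy class of subgroups of $\pi(\Lambda,x)$. (2) For all $x\in\Lambda^0$, $v\in p^{-1}(x)$ and $u\in q^{-1}(x)$, there is a morphism of coverings $(\Omega,p)\to(\Sigma,q)$ taking $v$ to $u$ if and only if $p_*\pi(\Omega,v)\subset q_*\pi(\Sigma,u)$. (3) Consequently, $(\Omega,p)\cong(\Sigma,q)$ if and only if the subgroups $p_*\pi(\Omega,v)$ and $q_*\pi(\Sigma,u)$ of $\pi(\Lambda,x)$ are conjugate for some, hence every, $x\in\Lambda^0$, $v\in p^{-1}(x)$ and $u\in q^{-1}(x)$.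
   Context: A $k$-graph is a small category $\Lambda$ (nonempty) with a functor $d:\Lambda\to\mathbb N^k$ (the degree) satisfying the factorization property: if $d(\alpha)=n+l$ with $n,l\in\mathbb N^k$, there are unique $\beta,\gamma\in\Lambda$ with $d(\beta)=n$, $d(\gamma)=l$, $\alpha=\beta\gamma$. $\Lambda^0$ is the set of objects (vertices, identified with identity morphisms); $s(\alpha)$ and $r(\alpha)$ are the domain and codomain of $\alpha$, and $\alpha\beta$ is defined when $s(\alpha)=r(\beta)$. $u\mathcal C=r^{-1}(u)$, $\mathcal C v=s^{-1}(v)$, $u\mathcal Cv=u\mathcal C\cap\mathcal Cv$. A small category $\mathcal C$ is connected if the equivalence relation on $\mathcal C^0$ generated by $\{(u,v)\mid u\mathcal Cv\neq\emptyset\}$ is all of $\mathcal C^0\times\mathcal C^0$. A $k$-graph morphism is a degree-preserving functor. A covering of $\Lambda$ is a surjective $k$-graph morphism $p:\Omega\to\Lambda$ such that for all $v\in\Omega^0$, $p$ maps $\Omega v$ bijectively onto $\Lambda p(v)$ and $v\Omega$ bijectively onto $p(v)\Lambda$. It is connected if $\Omega$ (hence $\Lambda$) is connected. A morphism of coverings $(\Omega,p)\to(\Sigma,q)$ of $\Lambda$ is a $k$-graph morphism $\phi:\Omega\to\Sigma$ with $q\circ\phi=p$. For $x\in\Lambda^0$, $p^{-1}(x)$ consists of vertices of $\Omega$. The fundamental groupoid of $\Lambda$ is the groupoid $\mathcal G(\Lambda)$ with $\mathcal G(\Lambda)^0=\Lambda^0$, together with a functor $i:\Lambda\to\mathcal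 G(\Lambda)$ that is the identity on $\Lambda^0$, such that every functor from $\Lambda$ to a groupoid factors uniquely through $i$. The fundamental group at $x\in\Lambda^0$ is $\pi(\Lambda,x)=x\mathcal G(\Lambda)x$. A covering $p$ induces by functoriality $p_*:\mathcal G(\Omega)\to\mathcal G(\Lambda)$ and homomorphisms $p_*:\pi(\Omega,v)\to\pi(\Lambda,p(v))$. *)

theory Defs
  imports "HOL-Algebra.Group" "HOL-Library.FuncSet"
begin

section \<open>Small categories, groupoids and functors\<close>

text \<open>
  A small category is given by its set of arrows; objects are identified with their identity
  arrows. Composition is written in the order of functions:
  \<open>a \<cdot> b\<close> is meaningful when \<open>src a = rng b\<close>.
\<close>

record 'a cat =
  Arr :: "'a set"
  src :: "'a \<Rightarrow> 'a"
  rng :: "'a \<Rightarrow> 'a"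
  cmp :: "'a \<Rightarrow> 'a \<Rightarrow> 'a"  (infixr "\<cdot>\<index>" 70)

definition Obj :: "('a, 'z) cat_scheme \<Rightarrow> 'a set" where
  "Obj C = {v \<in> Arr C. src C v = v}"

locale category =
  fixes C :: "('a, 'z) cat_scheme" (structure)
  assumes src_closed: "a \<in> Arr C \<Longrightarrow> src C a \<in> Arr C"
    and rng_closed: "a \<in> Arr C \<Longrightarrow> rng C a \<in> Arr C"
    and src_src: "a \<in> Arr C \<Longrightarrow> src C (src C a) = src C a"
    and rng_src: "a \<in> Arr C \<Longrightarrow> rng C (src C a) = src C a"
    and src_rng: "a \<in> Arr C \<Longrightarrow> src C (rng C a) = rng C a"
    and rng_rng: "a \<in> Arr C \<Longrightarrow> rng C (rng C a) = rng C a"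
    and cmp_closed: "\<lbrakk>a \<in> Arr C; b \<in> Arr C; src C a = rng C b\<rbrakk> \<Longrightarrow> a \<cdot> b \<in> Arr C"
    and src_cmp: "\<lbrakk>a \<in> Arr C; b \<in> Arr C; src C a = rng C b\<rbrakk> \<Longrightarrow> src C (a \<cdot> b) = src C b"
    and rng_cmp: "\<lbrakk>a \<in> Arr C; b \<in> Arr C; src C a = rng C b\<rbrakk> \<Longrightarrow> rng C (a \<cdot> b) = rng C a"
    and cmp_src: "a \<in> Arr C \<Longrightarrow> a \<cdot> src C a = a"
    and rng_cmp_left: "a \<in> Arr C \<Longrightarrow> rng C a \<cdot> a = a"
    and cmp_assoc: "\<lbrakk>a \<in> Arr C; b \<in> Arr C; c \<in> Arr C; src C a = rng C b; src C b = rng C c\<rbrakk>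
      \<Longrightarrow> (a \<cdot> b) \<cdot> c = a \<cdot> (b \<cdot> c)"

locale groupoid = category +
  assumes inverse_ex: "a \<in> Arr C \<Longrightarrow>
    \<exists>b \<in> Arr C. src C b = rng C a \<and> rng C b = src C a \<and> a \<cdot> b = rng C a \<and> b \<cdot> a = src C a"

text \<open>Only the restriction of \<open>F\<close> to the arrows is relevant; preservation of identities is
  contained in the preservation of source and range.\<close>

definition is_functor ::
  "('a, 'y) cat_scheme \<Rightarrow> ('b, 'z) cat_scheme \<Rightarrow> ('a \<Rightarrow> 'b) \<Rightarrow> bool" where
  "is_functor C D F \<longleftrightarrow>
     (\<forall>a \<in> Arr C. F a \<in> Arr D \<and> src D (F a) = F (src C a) \<and> rng D (F a) = F (rng C a)) \<and>
     (\<forall>a \<in> Arr C. \<forall>b \<in> Arr C. src C a = rng C b \<longrightarrow> F (a \<cdot>\<^bsub>C\<^esub> b) = F a \<cdot>\<^bsub>D\<^esub> F b)"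

definition connected_category :: "('a, 'z) cat_scheme \<Rightarrow> bool" where
  "connected_category C \<longleftrightarrow>
     (\<forall>u \<in> Obj C. \<forall>v \<in> Obj C.
        equivclp (\<lambda>u v. {a \<in> Arr C. rng C a = u \<and> src C a = v} \<noteq> {}) u v)"


section \<open>\<open>k\<close>-graphs and coverings\<close>

text \<open>The monoid of \<open>k\<close>-tuples of natural numbers, as functions vanishing from \<open>k\<close> on.\<close>

definition deg_monoid :: "nat \<Rightarrow> (nat \<Rightarrow> nat) set" where
  "deg_monoid k = {n. \<forall>j \<ge> k. n j = 0}"

record 'a kgraph = "'a cat" +
  deg :: "'a \<Rightarrow> nat \<Rightarrow> nat"

locale kgraph = category L for k :: nat and L :: "('a, 'z) kgraph_scheme" (structure) +
  assumes nonempty: "Arr L \<noteq> {}"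
    and deg_closed: "a \<in> Arr L \<Longrightarrow> deg L a \<in> deg_monoid k"
    and deg_Obj: "v \<in> Obj L \<Longrightarrow> deg L v = (\<lambda>j. 0)"
    and deg_cmp: "\<lbrakk>a \<in> Arr L; b \<in> Arr L; src L a = rng L b\<rbrakk>
      \<Longrightarrow> deg L (a \<cdot> b) = (\<lambda>j. deg L a j + deg L b j)"
    and factorization:
      "\<lbrakk>a \<in> Arr L; m \<in> deg_monoid k; n \<in> deg_monoid k; deg L a = (\<lambda>j. m j + n j)\<rbrakk>
      \<Longrightarrow> \<exists>!(b, c). b \<in> Arr L \<and> c \<in> Arr L \<and> src L b = rng L c \<and>
            deg L b = m \<and> deg L c = n \<and> a = b \<cdot> c"

definition kgraph_morphism ::
  "('a, 'y) kgraph_scheme \<Rightarrow> ('b, 'z) kgraph_scheme \<Rightarrow> ('a \<Rightarrow> 'b) \<Rightarrow> bool" where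
  "kgraph_morphism L M f \<longleftrightarrow> is_functor L M f \<and> (\<forall>a \<in> Arr L. deg M (f a) = deg L a)"

definition covering ::
  "nat \<Rightarrow> ('l, 'y) kgraph_scheme \<Rightarrow> ('o, 'z) kgraph_scheme \<Rightarrow> ('o \<Rightarrow> 'l) \<Rightarrow> bool" where
  "covering k L Om p \<longleftrightarrow>
     kgraph k L \<and> kgraph k Om \<and> kgraph_morphism Om L p \<and> p ` Arr Om = Arr L \<and>
     (\<forall>v \<in> Obj Om.
        bij_betw p {a \<in> Arr Om. src Om a = v} {b \<in> Arr L. src L b = p v} \<and>
        bij_betw p {a \<in> Arr Om. rng Om a = v} {b \<in> Arr L. rng L b = p v})"

definition connected_covering ::
  "nat \<Rightarrow> ('l, 'y) kgraph_scheme \<Rightarrow> ('o, 'z) kgraph_scheme \<Rightarrow> ('o \<Rightarrow> 'l) \<Rightarrow> bool" where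
  "connected_covering k L Om p \<longleftrightarrow> covering k L Om p \<and> connected_category Om"

definition covering_morphism ::
  "('o, 'y) kgraph_scheme \<Rightarrow> ('o \<Rightarrow> 'l) \<Rightarrow> ('s, 'z) kgraph_scheme \<Rightarrow> ('s \<Rightarrow> 'l) \<Rightarrow> ('o \<Rightarrow> 's) \<Rightarrow> bool"
  where
  "covering_morphism Om p Si q \<phi> \<longleftrightarrow>
     kgraph_morphism Om Si \<phi> \<and> (\<forall>a \<in> Arr Om. q (\<phi> a) = p a)"

definition coverings_isomorphic ::
  "('o, 'y) kgraph_scheme \<Rightarrow> ('o \<Rightarrow> 'l) \<Rightarrow> ('s, 'z) kgraph_scheme \<Rightarrow> ('s \<Rightarrow> 'l) \<Rightarrow> bool" where
  "coverings_isomorphic Om p Si q \<longleftrightarrow>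
     (\<exists>\<phi> \<psi>. covering_morphism Om p Si q \<phi> \<and> covering_morphism Si q Om p \<psi> \<and>
        (\<forall>a \<in> Arr Om. \<psi> (\<phi> a) = a) \<and> (\<forall>b \<in> Arr Si. \<phi> (\<psi> b) = b))"

definition fibre :: "('o, 'z) cat_scheme \<Rightarrow> ('o \<Rightarrow> 'l) \<Rightarrow> 'l \<Rightarrow> 'o set" where
  "fibre Om p x = {v \<in> Obj Om. p v = x}"


section \<open>The fundamental groupoid\<close>

text \<open>\<open>universal_at TYPE('h) L G i\<close>: every functor from \<open>L\<close> to a groupoid with arrows in the
  type \<open>'h\<close> factors uniquely through \<open>i\<close>. Extensionality makes functors determined by their
  values on arrows, so that uniqueness is meaningful.\<close>

definition universal_at ::
  "'h itself \<Rightarrow> ('a, 'z) cat_scheme \<Rightarrow> 'g cat \<Rightarrow> ('a \<Rightarrow> 'g) \<Rightarrow> bool" where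
  "universal_at T L G i \<longleftrightarrow>
     (\<forall>(H :: 'h cat) f. groupoid H \<and> is_functor L H f \<longrightarrow>
        (\<exists>!F. F \<in> extensional (Arr G) \<and> is_functor G H F \<and> (\<forall>a \<in> Arr L. F (i a) = f a)))"

text \<open>
  As objects are identity arrows and the arrows of \<open>G\<close> live in a type of their own, the
  requirement that \<open>G\<close> has the same objects as \<open>L\<close> and \<open>i\<close> is the identity on them reads: \<open>i\<close> is
  a bijection of the objects; the object of \<open>G\<close> corresponding to \<open>x\<close> is \<open>i x\<close>.

  A definition in HOL cannot quantify over all types of arrows of the test groupoid. It suffices to
  demand the universal property for the type of \<open>G\<close> itself and for the type \<open>('a \<times> bool) list set\<close>,
  which is large enough to contain a fundamental groupoid: by \<open>fundamental_groupoid_universal\<close>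
  below, the universal property then holds for test groupoids of any type, and by
  \<open>fundamental_groupoid_exists\<close> every category has a fundamental groupoid.
\<close>

definition fundamental_groupoid ::
  "('a, 'z) cat_scheme \<Rightarrow> 'g cat \<Rightarrow> ('a \<Rightarrow> 'g) \<Rightarrow> bool" where
  "fundamental_groupoid L G i \<longleftrightarrow>
     groupoid G \<and> is_functor L G i \<and> bij_betw i (Obj L) (Obj G) \<and>
     universal_at TYPE('g) L G i \<and> universal_at TYPE(('a \<times> bool) list set) L G i"

definition fundamental_group :: "'g cat \<Rightarrow> ('a \<Rightarrow> 'g) \<Rightarrow> 'a \<Rightarrow> 'g monoid" where
  "fundamental_group G i x =
     \<lparr>carrier = {g \<in> Arr G. rng G g = i x \<and> src G g = i x}, mult = cmp G, one = i x\<rparr>"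

text \<open>The functor between fundamental groupoids \<open>(G, i)\<close> of \<open>Om\<close> and \<open>(H, j)\<close> of \<open>L\<close> induced by
  a functor \<open>p\<close> from \<open>Om\<close> to \<open>L\<close>; see \<open>induced_functor\<close> below.\<close>

definition induced ::
  "('o, 'z) cat_scheme \<Rightarrow> 'g cat \<Rightarrow> ('o \<Rightarrow> 'g) \<Rightarrow> 'h cat \<Rightarrow> ('l \<Rightarrow> 'h) \<Rightarrow> ('o \<Rightarrow> 'l) \<Rightarrow> 'g \<Rightarrow> 'h" where
  "induced Om G i H j p =
     (THE F. F \<in> extensional (Arr G) \<and> is_functor G H F \<and> (\<forall>a \<in> Arr Om. F (i a) = j (p a)))"

text \<open>The image of the fundamental group of \<open>Om\<close> at \<open>v\<close> in that of \<open>L\<close> at \<open>p v\<close>.\<close>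

definition induced_image ::
  "('o, 'z) cat_scheme \<Rightarrow> 'g cat \<Rightarrow> ('o \<Rightarrow> 'g) \<Rightarrow> 'h cat \<Rightarrow> ('l \<Rightarrow> 'h) \<Rightarrow> ('o \<Rightarrow> 'l) \<Rightarrow> 'o \<Rightarrow> 'h set"
  where
  "induced_image Om G i H j p v = induced Om G i H j p ` carrier (fundamental_group G i v)"


section \<open>Conjugate subgroups\<close>

definition conjugate_subgroups :: "('g, 'z) monoid_scheme \<Rightarrow> 'g set \<Rightarrow> 'g set \<Rightarrow> bool" where
  "conjugate_subgroups G H K \<longleftrightarrow>
     subgroup H G \<and> subgroup K G \<and>
     (\<exists>g \<in> carrier G. K = (\<lambda>h. g \<otimes>\<^bsub>G\<^esub> h \<otimes>\<^bsub>G\<^esub> inv\<^bsub>G\<^esub> g) ` H)"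

definition conjugacy_class_of_subgroups :: "('g, 'z) monoid_scheme \<Rightarrow> 'g set set \<Rightarrow> bool" where
  "conjugacy_class_of_subgroups G S \<longleftrightarrow>
     (\<exists>H. subgroup H G \<and> S = {K. conjugate_subgroups G H K})"


section \<open>Existence of fundamental groupoids\<close>

text \<open>The fundamental groupoid is realised by classes of nonempty zigzags: \<open>(a, True)\<close> stands
  for \<open>a\<close> and \<open>(a, False)\<close> for its formal inverse.\<close>

definition lsrc :: "('a, 'z) cat_scheme \<Rightarrow> 'a \<times> bool \<Rightarrow> 'a" where
  "lsrc C e = (if snd e then src C (fst e) else rng C (fst e))"

definition lrng :: "('a, 'z) cat_scheme \<Rightarrow> 'a \<times> bool \<Rightarrow> 'a" where
  "lrng C e = (if snd e then rng C (fst e) else src C (fst e))"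

fun zigzag :: "('a, 'z) cat_scheme \<Rightarrow> ('a \<times> bool) list \<Rightarrow> bool" where
  "zigzag C [] = False"
| "zigzag C [e] = (fst e \<in> Arr C)"
| "zigzag C (e # f # w) = (fst e \<in> Arr C \<and> lsrc C e = lrng C f \<and> zigzag C (f # w))"

abbreviation wsrc :: "('a, 'z) cat_scheme \<Rightarrow> ('a \<times> bool) list \<Rightarrow> 'a" where
  "wsrc C w \<equiv> lsrc C (last w)"

abbreviation wrng :: "('a, 'z) cat_scheme \<Rightarrow> ('a \<times> bool) list \<Rightarrow> 'a" where
  "wrng C w \<equiv> lrng C (hd w)"

definition zz_flip :: "'a \<times> bool \<Rightarrow> 'a \<times> bool" where
  "zz_flip e = (fst e, \<not> snd e)"

lemma zz_flip_simps [simp]: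
  "fst (zz_flip e) = fst e" "lsrc C (zz_flip e) = lrng C e" "lrng C (zz_flip e) = lsrc C e"
  "zz_flip (zz_flip e) = e"
  by (simp_all add: zz_flip_def lsrc_def lrng_def)

definition zz_inverse :: "('a \<times> bool) list \<Rightarrow> ('a \<times> bool) list" where
  "zz_inverse w = map zz_flip (rev w)"

inductive zz_eq :: "('a, 'z) cat_scheme \<Rightarrow> ('a \<times> bool) list \<Rightarrow> ('a \<times> bool) list \<Rightarrow> bool"
  for C where
  zz_refl: "zigzag C w \<Longrightarrow> zz_eq C w w"
| zz_sym: "zz_eq C u v \<Longrightarrow> zz_eq C v u"
| zz_trans: "zz_eq C u v \<Longrightarrow> zz_eq C v w \<Longrightarrow> zz_eq C u w"
| zz_append: "zz_eq C u u' \<Longrightarrow> zz_eq C v v' \<Longrightarrow> wsrc C u = wrng C v \<Longrightarrow> zz_eq C (u @ v) (u' @ v')"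
| zz_cmp: "a \<in> Arr C \<Longrightarrow> b \<in> Arr C \<Longrightarrow> src C a = rng C b \<Longrightarrow>
    zz_eq C [(a, True), (b, True)] [(a \<cdot>\<^bsub>C\<^esub> b, True)]"
| zz_inv_right: "a \<in> Arr C \<Longrightarrow> zz_eq C [(a, True), (a, False)] [(rng C a, True)]"
| zz_inv_left: "a \<in> Arr C \<Longrightarrow> zz_eq C [(a, False), (a, True)] [(src C a, True)]"
| zz_id_left: "a \<in> Arr C \<Longrightarrow> zz_eq C [(src C a, True), (a, False)] [(a, False)]"
| zz_id_right: "a \<in> Arr C \<Longrightarrow> zz_eq C [(a, False), (rng C a, True)] [(a, False)]"

definition zz_class :: "('a, 'z) cat_scheme \<Rightarrow> ('a \<times> bool) list \<Rightarrow> ('a \<times> bool) list set" where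
  "zz_class C w = {w'. zz_eq C w w'}"

definition zz_rep :: "('a \<times> bool) list set \<Rightarrow> ('a \<times> bool) list" where
  "zz_rep X = (SOME w. w \<in> X)"

definition zz_groupoid :: "('a, 'z) cat_scheme \<Rightarrow> ('a \<times> bool) list set cat" where
  "zz_groupoid C =
     \<lparr>Arr = zz_class C ` {w. zigzag C w},
      src = (\<lambda>X. zz_class C [(wsrc C (zz_rep X), True)]),
      rng = (\<lambda>X. zz_class C [(wrng C (zz_rep X), True)]),
      cmp = (\<lambda>X Y. zz_class C (zz_rep X @ zz_rep Y))\<rparr>"

definition zz_incl :: "('a, 'z) cat_scheme \<Rightarrow> 'a \<Rightarrow> ('a \<times> bool) list set" where
  "zz_incl C a = zz_class C [(a, True)]"

lemma zigzag_append:
  "u \<noteq> [] \<Longrightarrow> v \<noteq> [] \<Longrightarrow>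
    zigzag C (u @ v) \<longleftrightarrow> zigzag C u \<and> zigzag C v \<and> wsrc C u = wrng C v"
proof (induction C u rule: zigzag.induct)
  case (2 C e)
  then show ?case by (cases v) auto
qed auto

lemma zigzag_ne: "zigzag C w \<Longrightarrow> w \<noteq> []"
  by auto

lemma zigzag_ends:
  assumes "zigzag C w"
  shows "fst (hd w) \<in> Arr C" "fst (last w) \<in> Arr C"
  using assms by (induction C w rule: zigzag.induct) auto

context category
begin

lemma zz_eq_zigzag:
  "zz_eq C u v \<Longrightarrow> zigzag C u \<and> zigzag C v \<and> wsrc C u = wsrc C v \<and> wrng C u = wrng C v"
proof (induction rule: zz_eq.induct)
  case (zz_append u u' v v')
  then have "u \<noteq> []" "u' \<noteq> []" "v \<noteq> []" "v' \<noteq> []" by auto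
  with zz_append show ?case by (auto simp: zigzag_append)
qed (auto simp: lsrc_def lrng_def src_closed rng_closed src_src rng_src src_rng rng_rng
        cmp_closed src_cmp rng_cmp)

lemma zz_class_eq: "zigzag C u \<Longrightarrow> zz_class C u = zz_class C v \<longleftrightarrow> zz_eq C u v"
proof
  assume u: "zigzag C u" and "zz_class C u = zz_class C v"
  then have "v \<in> zz_class C u \<or> \<not> zz_eq C v v" "u \<in> zz_class C v"
    using zz_refl[OF u] by (auto simp: zz_class_def)
  then show "zz_eq C u v" by (auto simp: zz_class_def intro: zz_sym)
next
  assume "zz_eq C u v"
  then show "zz_class C u = zz_class C v"
    by (auto simp: zz_class_def intro: zz_sym zz_trans)
qed

lemma zz_rep_eq: "zigzag C w \<Longrightarrow> zz_eq C w (zz_rep (zz_class C w))"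
  unfolding zz_rep_def zz_class_def using someI[of "zz_eq C w" w] zz_refl[of C w] by simp

lemma zz_src: "zigzag C w \<Longrightarrow> src (zz_groupoid C) (zz_class C w) = zz_class C [(wsrc C w, True)]"
  using zz_eq_zigzag[OF zz_rep_eq[of w]] by (simp add: zz_groupoid_def)

lemma zz_rng: "zigzag C w \<Longrightarrow> rng (zz_groupoid C) (zz_class C w) = zz_class C [(wrng C w, True)]"
  using zz_eq_zigzag[OF zz_rep_eq[of w]] by (simp add: zz_groupoid_def)

lemma wsrc_closed: "zigzag C w \<Longrightarrow> wsrc C w \<in> Arr C"
  using zigzag_ends[of C w] by (auto simp: lsrc_def src_closed rng_closed)

lemma wrng_closed: "zigzag C w \<Longrightarrow> wrng C w \<in> Arr C"
  using zigzag_ends[of C w] by (auto simp: lrng_def src_closed rng_closed)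

lemma src_wsrc: "zigzag C w \<Longrightarrow> src C (wsrc C w) = wsrc C w" "zigzag C w \<Longrightarrow> rng C (wsrc C w) = wsrc C w"
  using zigzag_ends[of C w] by (auto simp: lsrc_def src_src src_rng rng_src rng_rng)

lemma src_wrng: "zigzag C w \<Longrightarrow> src C (wrng C w) = wrng C w" "zigzag C w \<Longrightarrow> rng C (wrng C w) = wrng C w"
  using zigzag_ends[of C w] by (auto simp: lrng_def src_src src_rng rng_src rng_rng)

lemma zz_composable:
  assumes "zigzag C u" "zigzag C v"
  shows "src (zz_groupoid C) (zz_class C u) = rng (zz_groupoid C) (zz_class C v)
    \<longleftrightarrow> wsrc C u = wrng C v"
proof
  assume "src (zz_groupoid C) (zz_class C u) = rng (zz_groupoid C) (zz_class C v)"
  then have "zz_eq C [(wsrc C u, True)] [(wrng C v, True)]"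
    using zz_class_eq[of "[(wsrc C u, True)]" "[(wrng C v, True)]"] assms
    by (simp add: zz_src zz_rng wsrc_closed)
  from zz_eq_zigzag[OF this] show "wsrc C u = wrng C v"
    using assms by (simp add: lsrc_def src_wsrc src_wrng del: One_nat_def) 
      (metis lsrc_def src_wrng(1) src_wsrc(1))
qed (use assms in \<open>simp add: zz_src zz_rng\<close>)

lemma zz_comp:
  assumes "zigzag C u" "zigzag C v" "wsrc C u = wrng C v"
  shows "zz_class C u \<cdot>\<^bsub>zz_groupoid C\<^esub> zz_class C v = zz_class C (u @ v)"
proof -
  have "zz_eq C (u @ v) (zz_rep (zz_class C u) @ zz_rep (zz_class C v))"
    using assms by (intro zz_append zz_rep_eq)
  then show ?thesis
    using zz_class_eq[THEN iffD2, of "u @ v"] assms zigzag_ne[of C u] zigzag_ne[of C v]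
    by (simp add: zz_groupoid_def zigzag_append)
qed

lemma zz_letter_id_left:
  assumes "fst e \<in> Arr C" shows "zz_eq C [(lrng C e, True), e] [e]"
proof (cases e)
  case (Pair a s)
  then show ?thesis
    using assms zz_cmp[of "rng C a" C a] zz_id_left[of a C]
    by (cases s) (auto simp: lrng_def rng_closed src_rng rng_cmp_left)
qed

lemma zz_letter_id_right:
  assumes "fst e \<in> Arr C" shows "zz_eq C [e, (lsrc C e, True)] [e]"
proof (cases e)
  case (Pair a s)
  then show ?thesis
    using assms zz_cmp[of a C "src C a"] zz_id_right[of a C]
    by (cases s) (auto simp: lsrc_def src_closed rng_src cmp_src)
qed

lemma zz_word_id_left:
  assumes "zigzag C w" shows "zz_eq C ((wrng C w, True) # w) w"
proof (cases w)
  case Nil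
  with assms show ?thesis by simp
next
  case (Cons e v)
  have e: "fst e \<in> Arr C" using zigzag_ends[OF assms] Cons by simp
  show ?thesis
  proof (cases "v = []")
    case True
    then show ?thesis using zz_letter_id_left[OF e] Cons by simp
  next
    case False
    have "zigzag C ([e] @ v)" using assms Cons by simp
    then have v: "zigzag C v" "lsrc C e = wrng C v"
      using zigzag_append[of "[e]" v C] False by auto
    have "zz_eq C ([(lrng C e, True), e] @ v) ([e] @ v)"
      using v by (intro zz_append zz_letter_id_left e zz_refl) auto
    then show ?thesis using Cons by simp
  qed
qed

lemma zz_word_id_right:
  assumes "zigzag C w" shows "zz_eq C (w @ [(wsrc C w, True)]) w"
proof (cases w rule: rev_cases)
  case Nil
  with assms show ?thesis by simp
next
  case (snoc v e)
  have e: "fst e \<in> Arr C" using zigzag_ends[OF assms] snoc by simp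
  show ?thesis
  proof (cases "v = []")
    case True
    then show ?thesis using zz_letter_id_right[OF e] snoc by simp
  next
    case False
    have "zigzag C (v @ [e])" using assms snoc by simp
    then have v: "zigzag C v" "wsrc C v = lrng C e"
      using zigzag_append[of v "[e]" C] False by auto
    have "zz_eq C (v @ [e, (lsrc C e, True)]) (v @ [e])"
      using v by (intro zz_append zz_letter_id_right e zz_refl) auto
    then show ?thesis using snoc by simp
  qed
qed

lemma zz_Arr: "X \<in> Arr (zz_groupoid C) \<longleftrightarrow> (\<exists>w. zigzag C w \<and> X = zz_class C w)"
  by (auto simp: zz_groupoid_def)

lemma zz_id_zigzag:
  "zigzag C w \<Longrightarrow> zigzag C [(wsrc C w, True)]" "zigzag C w \<Longrightarrow> zigzag C [(wrng C w, True)]"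
  by (simp_all add: wsrc_closed wrng_closed)

lemma zz_id_ends:
  assumes "zigzag C w"
  shows "lsrc C (wsrc C w, True) = wsrc C w" "lrng C (wsrc C w, True) = wsrc C w"
    "lsrc C (wrng C w, True) = wrng C w" "lrng C (wrng C w, True) = wrng C w"
  using src_wsrc[OF assms] src_wrng[OF assms] lsrc_def[of C] lrng_def[of C] by simp_all

lemma category_zz: "category (zz_groupoid C)"
proof
  let ?Z = "zz_groupoid C"
  show "src ?Z X \<in> Arr ?Z" "rng ?Z X \<in> Arr ?Z" "src ?Z (src ?Z X) = src ?Z X"
    "rng ?Z (src ?Z X) = src ?Z X" "src ?Z (rng ?Z X) = rng ?Z X" "rng ?Z (rng ?Z X) = rng ?Z X"
    if "X \<in> Arr ?Z" for X
  proof -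
    from that obtain w where w: "zigzag C w" "X = zz_class C w" by (auto simp: zz_Arr)
    note * = zz_id_zigzag[OF w(1)] zz_id_ends[OF w(1)]
    show "src ?Z X \<in> Arr ?Z" "rng ?Z X \<in> Arr ?Z" 
      using * w by (auto simp: zz_Arr zz_src zz_rng simp del: zigzag.simps)
    show "src ?Z (src ?Z X) = src ?Z X"
      "rng ?Z (src ?Z X) = src ?Z X" "src ?Z (rng ?Z X) = rng ?Z X" "rng ?Z (rng ?Z X) = rng ?Z X"
      using * w by (simp_all add: zz_src zz_rng del: zigzag.simps)
  qed
  show "X \<cdot>\<^bsub>?Z\<^esub> Y \<in> Arr ?Z" "src ?Z (X \<cdot>\<^bsub>?Z\<^esub> Y) = src ?Z Y" "rng ?Z (X \<cdot>\<^bsub>?Z\<^esub> Y) = rng ?Z X"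
    if XY: "X \<in> Arr ?Z" "Y \<in> Arr ?Z" "src ?Z X = rng ?Z Y" for X Y
  proof -
    from XY obtain u v where u: "zigzag C u" "X = zz_class C u"
      and v: "zigzag C v" "Y = zz_class C v" by (auto simp: zz_Arr)
    have uv: "wsrc C u = wrng C v" using XY u v zz_composable by simp
    have ne: "u \<noteq> []" "v \<noteq> []" using u v by auto
    have z: "zigzag C (u @ v)" using u v uv ne by (simp add: zigzag_append)
    show "X \<cdot>\<^bsub>?Z\<^esub> Y \<in> Arr ?Z" "src ?Z (X \<cdot>\<^bsub>?Z\<^esub> Y) = src ?Z Y" "rng ?Z (X \<cdot>\<^bsub>?Z\<^esub> Y) = rng ?Z X"
      using u v uv ne z by (auto simp: zz_comp zz_Arr zz_src zz_rng)
  qed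
  show "X \<cdot>\<^bsub>?Z\<^esub> src ?Z X = X" "rng ?Z X \<cdot>\<^bsub>?Z\<^esub> X = X" if "X \<in> Arr ?Z" for X
  proof -
    from that obtain w where w: "zigzag C w" "X = zz_class C w" by (auto simp: zz_Arr)
    note * = zz_id_zigzag[OF w(1)] zz_id_ends[OF w(1)]
    have ne: "w \<noteq> []" using w by auto
    have "zigzag C (w @ [(wsrc C w, True)])" "zigzag C ([(wrng C w, True)] @ w)"
      using zz_eq_zigzag[OF zz_word_id_left[OF w(1)]] zz_eq_zigzag[OF zz_word_id_right[OF w(1)]]
      by simp_all
    then show "X \<cdot>\<^bsub>?Z\<^esub> src ?Z X = X" "rng ?Z X \<cdot>\<^bsub>?Z\<^esub> X = X"
      using * w zz_word_id_left[OF w(1)] zz_word_id_right[OF w(1)]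
      by (simp_all add: zz_comp zz_class_eq zz_src zz_rng del: zigzag.simps)
  qed
  show "(X \<cdot>\<^bsub>?Z\<^esub> Y) \<cdot>\<^bsub>?Z\<^esub> W = X \<cdot>\<^bsub>?Z\<^esub> Y \<cdot>\<^bsub>?Z\<^esub> W"
    if XY: "X \<in> Arr ?Z" "Y \<in> Arr ?Z" "W \<in> Arr ?Z" "src ?Z X = rng ?Z Y" "src ?Z Y = rng ?Z W"
    for X Y W
  proof -
    from XY obtain u v w where u: "zigzag C u" "X = zz_class C u"
      and v: "zigzag C v" "Y = zz_class C v" and w: "zigzag C w" "W = zz_class C w"
      by (auto simp: zz_Arr)
    have uv: "wsrc C u = wrng C v" "wsrc C v = wrng C w" using XY u v w zz_composable by simp_all
    have ne: "u \<noteq> []" "v \<noteq> []" "w \<noteq> []" using u v w by auto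
    have z: "zigzag C (u @ v)" "zigzag C (v @ w)" using u v w uv ne by (simp_all add: zigzag_append)
    show ?thesis using u v w uv ne z by (simp add: zz_comp)
  qed
qed

lemma zz_letter_inverse:
  assumes "fst e \<in> Arr C" shows "zz_eq C [e, zz_flip e] [(lrng C e, True)]"
  using assms zz_inv_left[of "fst e" C] zz_inv_right[of "fst e" C]
  by (cases e; cases "snd e"; simp add: lsrc_def lrng_def zz_flip_def)

lemma zz_inverse_zigzag:
  "zigzag C w \<Longrightarrow> zigzag C (zz_inverse w) \<and> wsrc C (zz_inverse w) = wrng C w \<and>
     wrng C (zz_inverse w) = wsrc C w"
proof (induction w)
  case (Cons e v)
  show ?case
  proof (cases "v = []")
    case True
    with Cons show ?thesis by (simp add: zz_inverse_def)
  next
    case False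
    have "zigzag C ([e] @ v)" using Cons by simp
    then have v: "zigzag C v" "lsrc C e = wrng C v" "fst e \<in> Arr C"
      using zigzag_append[of "[e]" v C] False by auto
    have *: "zz_inverse (e # v) = zz_inverse v @ [zz_flip e]" "zz_inverse v \<noteq> []"
      using False by (auto simp: zz_inverse_def)
    with Cons.IH[OF v(1)] v False show ?thesis by (simp add: zigzag_append)
  qed
qed simp

lemma zz_inverse_right:
  "zigzag C w \<Longrightarrow> zz_eq C (w @ zz_inverse w) [(wrng C w, True)]"
proof (induction w)
  case (Cons e v)
  show ?case
  proof (cases "v = []")
    case True
    with Cons zz_letter_inverse[of e] show ?thesis by (simp add: zz_inverse_def)
  next
    case False
    have "zigzag C ([e] @ v)" using Cons by simp
    then have v: "zigzag C v" "lsrc C e = wrng C v" "fst e \<in> Arr C"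
      using zigzag_append[of "[e]" v C] False by auto
    have f: "zz_eq C [zz_flip e] [zz_flip e]" "zz_eq C [e] [e]" using v by (auto intro: zz_refl)
    have 1: "zz_eq C (v @ zz_inverse v) [(wrng C v, True)]" by (rule Cons.IH[OF v(1)])
    have ne: "zz_inverse v \<noteq> []" using False by (simp add: zz_inverse_def)
    have 2: "zz_eq C ([e] @ (v @ zz_inverse v)) ([e] @ [(wrng C v, True)])"
      using v False by (intro zz_append f 1) simp
    have "zz_eq C ([e] @ [(wrng C v, True)]) [e]"
      using zz_letter_id_right[OF v(3)] v(2) by simp
    then have 3: "zz_eq C ([e] @ (v @ zz_inverse v)) [e]" using 2 by (rule zz_trans[rotated])
    have "zz_eq C (([e] @ (v @ zz_inverse v)) @ [zz_flip e]) ([e] @ [zz_flip e])"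
      using ne zz_inverse_zigzag[OF v(1)] v by (intro zz_append f 3) simp
    then show ?thesis
      using zz_letter_inverse[OF v(3)] by (auto simp: zz_inverse_def intro: zz_trans)
  qed
qed simp

lemma groupoid_zz: "groupoid (zz_groupoid C)"
proof -
  let ?Z = "zz_groupoid C"
  interpret Z: category ?Z by (rule category_zz)
  show ?thesis
  proof
    fix X assume "X \<in> Arr ?Z"
    then obtain w where w: "zigzag C w" "X = zz_class C w" by (auto simp: zz_Arr)
    note i = zz_inverse_zigzag[OF w(1)]
    have inv: "zz_inverse (zz_inverse w) = w" by (simp add: zz_inverse_def rev_map comp_def)
    have 1: "zz_class C (w @ zz_inverse w) = zz_class C [(wrng C w, True)]"
      using zz_inverse_right[OF w(1)] zz_eq_zigzag zz_class_eq by blast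
    have 2: "zz_class C (zz_inverse w @ w) = zz_class C [(wsrc C w, True)]"
      using zz_inverse_right[of "zz_inverse w"] zz_eq_zigzag zz_class_eq i unfolding inv by metis
    show "\<exists>Y \<in> Arr ?Z. src ?Z Y = rng ?Z X \<and> rng ?Z Y = src ?Z X \<and>
      X \<cdot>\<^bsub>?Z\<^esub> Y = rng ?Z X \<and> Y \<cdot>\<^bsub>?Z\<^esub> X = src ?Z X"
      using i w 1 2 by (intro bexI[of _ "zz_class C (zz_inverse w)"])
        (auto simp: zz_src zz_rng zz_comp zz_Arr)
  qed
qed

lemma zz_incl_functor: "is_functor C (zz_groupoid C) (zz_incl C)"
proof -
  have "zz_class C [(a, True)] \<cdot>\<^bsub>zz_groupoid C\<^esub> zz_class C [(b, True)] = zz_class C [(a \<cdot> b, True)]"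
    if "a \<in> Arr C" "b \<in> Arr C" "src C a = rng C b" for a b
    using that zz_cmp[of a C b] zz_class_eq[of "[(a, True), (b, True)]"]
    by (simp add: zz_comp lsrc_def lrng_def)
  then show ?thesis
    by (auto simp: is_functor_def zz_incl_def zz_Arr zz_src zz_rng lsrc_def lrng_def
        intro!: exI[of _ "[(_, True)]"])
qed

lemma zz_incl_Obj: "bij_betw (zz_incl C) (Obj C) (Obj (zz_groupoid C))"
proof (rule bij_betwI')
  fix u v assume uv: "u \<in> Obj C" "v \<in> Obj C"
  then have o: "u \<in> Arr C" "v \<in> Arr C" "src C u = u" "src C v = v" by (auto simp: Obj_def)
  have "u = v" if "zz_incl C u = zz_incl C v"
  proof -
    have "zz_eq C [(u, True)] [(v, True)]"
      using that o by (simp add: zz_incl_def zz_class_eq)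
    from zz_eq_zigzag[OF this] show ?thesis using o by (simp add: lsrc_def)
  qed
  then show "zz_incl C u = zz_incl C v \<longleftrightarrow> u = v" by auto
next
  fix v assume "v \<in> Obj C"
  then show "zz_incl C v \<in> Obj (zz_groupoid C)"
    using zz_incl_functor by (auto simp: Obj_def is_functor_def)
next
  fix X assume "X \<in> Obj (zz_groupoid C)"
  then obtain w where w: "zigzag C w" "X = zz_class C w" "src (zz_groupoid C) X = X"
    by (auto simp: zz_Arr Obj_def)
  then have "X = zz_incl C (wsrc C w)" by (simp add: zz_src zz_incl_def)
  moreover have "wsrc C w \<in> Obj C" using wsrc_closed src_wsrc w(1) by (simp add: Obj_def)
  ultimately show "\<exists>v \<in> Obj C. X = zz_incl C v" by blast
qed

end

lemma (in groupoid) inverse_unique: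
  assumes "a \<in> Arr C" "b \<in> Arr C" "b' \<in> Arr C"
    "src C b = rng C a" "rng C b = src C a" "b \<cdot> a = src C a"
    "src C b' = rng C a" "rng C b' = src C a" "a \<cdot> b' = rng C a"
  shows "b = b'"
proof -
  have "b = b \<cdot> (a \<cdot> b')" using assms cmp_src[of b] by simp
  also have "\<dots> = (b \<cdot> a) \<cdot> b'" using assms cmp_assoc[of b a b'] by simp
  also have "\<dots> = b'" using assms rng_cmp_left[of b'] by simp
  finally show ?thesis .
qed

definition ginv :: "('g, 'z) cat_scheme \<Rightarrow> 'g \<Rightarrow> 'g" where
  "ginv H a = (SOME b. b \<in> Arr H \<and> src H b = rng H a \<and> rng H b = src H a \<and>
     a \<cdot>\<^bsub>H\<^esub> b = rng H a \<and> b \<cdot>\<^bsub>H\<^esub> a = src H a)"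

lemma (in groupoid) ginv:
  assumes "a \<in> Arr C"
  shows "ginv C a \<in> Arr C" "src C (ginv C a) = rng C a" "rng C (ginv C a) = src C a"
    "a \<cdot> ginv C a = rng C a" "ginv C a \<cdot> a = src C a"
proof -
  have "ginv C a \<in> Arr C \<and> src C (ginv C a) = rng C a \<and> rng C (ginv C a) = src C a \<and>
     a \<cdot> ginv C a = rng C a \<and> ginv C a \<cdot> a = src C a"
    unfolding ginv_def by (rule someI_ex) (use inverse_ex[OF assms] in blast)
  then show "ginv C a \<in> Arr C" "src C (ginv C a) = rng C a" "rng C (ginv C a) = src C a"
    "a \<cdot> ginv C a = rng C a" "ginv C a \<cdot> a = src C a" by auto
qed

definition zz_eval1 :: "('h, 'z) cat_scheme \<Rightarrow> ('a \<Rightarrow> 'h) \<Rightarrow> 'a \<times> bool \<Rightarrow> 'h" where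
  "zz_eval1 H f e = (if snd e then f (fst e) else ginv H (f (fst e)))"

fun zz_eval :: "('h, 'z) cat_scheme \<Rightarrow> ('a \<Rightarrow> 'h) \<Rightarrow> ('a \<times> bool) list \<Rightarrow> 'h" where
  "zz_eval H f [] = undefined"
| "zz_eval H f [e] = zz_eval1 H f e"
| "zz_eval H f (e # v # w) = zz_eval1 H f e \<cdot>\<^bsub>H\<^esub> zz_eval H f (v # w)"

locale zz_test = C: category C + H: groupoid H
  for C :: "('a, 'y) cat_scheme" and H :: "('h, 'z) cat_scheme" +
  fixes f :: "'a \<Rightarrow> 'h"
  assumes f: "is_functor C H f"
begin

lemma f_Arr:
  assumes "a \<in> Arr C"
  shows "f a \<in> Arr H" "src H (f a) = f (src C a)" "rng H (f a) = f (rng C a)"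
  using f assms by (auto simp: is_functor_def)

lemma f_cmp: "a \<in> Arr C \<Longrightarrow> b \<in> Arr C \<Longrightarrow> src C a = rng C b \<Longrightarrow> f (a \<cdot>\<^bsub>C\<^esub> b) = f a \<cdot>\<^bsub>H\<^esub> f b"
  using f by (auto simp: is_functor_def)

lemma eval1:
  assumes "fst e \<in> Arr C"
  shows "zz_eval1 H f e \<in> Arr H" "src H (zz_eval1 H f e) = f (lsrc C e)"
    "rng H (zz_eval1 H f e) = f (lrng C e)"
  using f_Arr[OF assms] H.ginv by (auto simp: zz_eval1_def lsrc_def lrng_def)

lemma eval:
  "zigzag C w \<Longrightarrow> zz_eval H f w \<in> Arr H \<and> src H (zz_eval H f w) = f (wsrc C w) \<and>
     rng H (zz_eval H f w) = f (wrng C w)"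
proof (induction w rule: induct_list012)
  case (3 e v w)
  then show ?case
    using eval1[of e] H.cmp_closed H.src_cmp H.rng_cmp by auto
qed (use eval1 in auto)

lemma eval_append:
  assumes "zigzag C u" "zigzag C v" "wsrc C u = wrng C v"
  shows "zz_eval H f (u @ v) = zz_eval H f u \<cdot>\<^bsub>H\<^esub> zz_eval H f v"
  using assms
proof (induction u rule: induct_list012)
  case (2 e)
  then show ?case by (cases v) auto
next
  case (3 e e' w)
  then have "fst e \<in> Arr C" "lsrc C e = lrng C e'" "zigzag C (e' # w)" by auto
  with 3 eval1[of e] eval[of "e' # w"] eval[of v] show ?case
    by (simp add: H.cmp_assoc)
qed auto

lemma eval_zz_eq: "zz_eq C u v \<Longrightarrow> zz_eval H f u = zz_eval H f v"
proof (induction rule: zz_eq.induct)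
  case (zz_append u u' v v')
  with C.zz_eq_zigzag[of u u'] C.zz_eq_zigzag[of v v'] show ?case by (simp add: eval_append)
next
  case (zz_id_left a)
  with f_Arr[of a] H.ginv[of "f a"] H.rng_cmp_left[of "ginv H (f a)"] show ?case
    by (simp add: zz_eval1_def)
next
  case (zz_id_right a)
  with f_Arr[of a] H.ginv[of "f a"] H.cmp_src[of "ginv H (f a)"] show ?case
    by (simp add: zz_eval1_def)
qed (simp_all add: zz_eval1_def f_cmp f_Arr H.ginv)

lemma universal:
  "\<exists>!F. F \<in> extensional (Arr (zz_groupoid C)) \<and> is_functor (zz_groupoid C) H F \<and>
     (\<forall>a \<in> Arr C. F (zz_incl C a) = f a)"
proof (rule ex_ex1I)
  let ?Z = "zz_groupoid C"
  define F where "F = restrict (\<lambda>X. zz_eval H f (zz_rep X)) (Arr ?Z)"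
  have F: "F (zz_class C w) = zz_eval H f w" if "zigzag C w" for w
    using eval_zz_eq[OF C.zz_rep_eq[OF that]] that by (auto simp: F_def C.zz_Arr)
  have F_id: "F (zz_class C [(a, True)]) = f a" if "a \<in> Arr C" for a
    using F[of "[(a, True)]"] that by (simp add: zz_eval1_def)
  have "is_functor ?Z H F"
    unfolding is_functor_def
  proof (intro conjI ballI impI)
    fix X assume "X \<in> Arr ?Z"
    then obtain w where w: "zigzag C w" "X = zz_class C w" by (auto simp: C.zz_Arr)
    then show "F X \<in> Arr H" "src H (F X) = F (src ?Z X)" "rng H (F X) = F (rng ?Z X)"
      using eval[of w] w by (simp_all add: F[OF w(1)] F_id C.zz_src C.zz_rng C.wsrc_closed C.wrng_closed)
  next
    fix X Y assume *: "X \<in> Arr ?Z" "Y \<in> Arr ?Z" "src ?Z X = rng ?Z Y"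
    then obtain u v where u: "zigzag C u" "X = zz_class C u"
      and v: "zigzag C v" "Y = zz_class C v" by (auto simp: C.zz_Arr)
    have uv: "wsrc C u = wrng C v" using * u v C.zz_composable by simp
    have "zigzag C (u @ v)"
      using u v uv zigzag_ne[of C u] zigzag_ne[of C v] by (simp add: zigzag_append)
    then show "F (X \<cdot>\<^bsub>?Z\<^esub> Y) = F X \<cdot>\<^bsub>H\<^esub> F Y"
      using u v uv by (simp add: C.zz_comp F eval_append)
  qed
  moreover have "F \<in> extensional (Arr ?Z)" by (simp add: F_def)
  ultimately show "\<exists>F. F \<in> extensional (Arr ?Z) \<and> is_functor ?Z H F \<and>
      (\<forall>a \<in> Arr C. F (zz_incl C a) = f a)"
    using F_id by (auto simp: zz_incl_def)
next
  let ?Z = "zz_groupoid C"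
  interpret Z: groupoid ?Z by (rule C.groupoid_zz)
  fix F F'
  assume F: "F \<in> extensional (Arr ?Z) \<and> is_functor ?Z H F \<and> (\<forall>a \<in> Arr C. F (zz_incl C a) = f a)"
    and F': "F' \<in> extensional (Arr ?Z) \<and> is_functor ?Z H F' \<and> (\<forall>a \<in> Arr C. F' (zz_incl C a) = f a)"
  have inverse: "K (zz_class C [(a, False)]) = ginv H (f a)"
    if K: "is_functor ?Z H K" "\<forall>a \<in> Arr C. K (zz_incl C a) = f a" and a: "a \<in> Arr C" for K a
  proof (rule H.inverse_unique[of "f a"])
    have i: "K (zz_class C [(a, True)]) = f a" "K (zz_class C [(src C a, True)]) = f (src C a)"
      "K (zz_class C [(rng C a, True)]) = f (rng C a)"
      using K a C.src_closed C.rng_closed by (auto simp: zz_incl_def)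
    have z: "zigzag C [(a, False)]" "zigzag C [(a, True)]" using a by simp_all
    then have A: "zz_class C [(a, False)] \<in> Arr ?Z" "zz_class C [(a, True)] \<in> Arr ?Z"
      using C.zz_Arr by blast+
    have Z: "src ?Z (zz_class C [(a, False)]) = zz_class C [(rng C a, True)]"
      "rng ?Z (zz_class C [(a, False)]) = zz_class C [(src C a, True)]"
      "rng ?Z (zz_class C [(a, True)]) = zz_class C [(rng C a, True)]"
      using C.zz_src[OF z(1)] C.zz_rng[OF z(1)] C.zz_rng[OF z(2)]
      by (simp_all add: lsrc_def lrng_def)
    have "zigzag C [(a, False), (a, True)]" using a by (simp add: lsrc_def lrng_def)
    then have c: "zz_class C [(a, False)] \<cdot>\<^bsub>?Z\<^esub> zz_class C [(a, True)] = zz_class C [(src C a, True)]"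
      using a C.zz_comp[OF z] zz_inv_left[OF a] C.zz_class_eq by (simp add: lsrc_def lrng_def)
    have k: "K X \<in> Arr H" "src H (K X) = K (src ?Z X)" "rng H (K X) = K (rng ?Z X)"
      if "X \<in> Arr ?Z" for X
      using K(1) that by (auto simp: is_functor_def)
    have kc: "K (X \<cdot>\<^bsub>?Z\<^esub> Y) = K X \<cdot>\<^bsub>H\<^esub> K Y"
      if "X \<in> Arr ?Z" "Y \<in> Arr ?Z" "src ?Z X = rng ?Z Y" for X Y
      using K(1) that by (auto simp: is_functor_def)
    show "K (zz_class C [(a, False)]) \<in> Arr H"
      "src H (K (zz_class C [(a, False)])) = rng H (f a)"
      "rng H (K (zz_class C [(a, False)])) = src H (f a)"
      using k[OF A(1)] i f_Arr[OF a] Z by simp_all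
    show "K (zz_class C [(a, False)]) \<cdot>\<^bsub>H\<^esub> f a = src H (f a)"
      using kc[OF A] c i f_Arr[OF a] Z by simp
  qed (use f_Arr[OF a] H.ginv[of "f a"] in auto)
  have letter: "F (zz_class C [e]) = F' (zz_class C [e])" if "fst e \<in> Arr C" for e
  proof (cases e)
    case (Pair a s)
    then show ?thesis
      using that F F' inverse[of F a] inverse[of F' a] by (cases s) (auto simp: zz_incl_def)
  qed
  have "F (zz_class C w) = F' (zz_class C w)" if "zigzag C w" for w
    using that
  proof (induction w rule: induct_list012)
    case (3 e e' w)
    then have *: "zigzag C [e]" "zigzag C (e' # w)" "wsrc C [e] = wrng C (e' # w)" by auto
    have split: "K (zz_class C (e # e' # w)) = K (zz_class C [e]) \<cdot>\<^bsub>H\<^esub> K (zz_class C (e' # w))"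
      if "is_functor ?Z H K" for K
    proof -
      have "zz_class C [e] \<in> Arr ?Z" "zz_class C (e' # w) \<in> Arr ?Z" using * C.zz_Arr by blast+
      then show ?thesis
        using that *(3) C.zz_comp[OF *] C.zz_composable[OF *(1,2)]
        unfolding is_functor_def append_Cons append_Nil by metis
    qed
    have "F (zz_class C [e]) = F' (zz_class C [e])" using * letter by simp
    moreover have "F (zz_class C (e' # w)) = F' (zz_class C (e' # w))" using "3.IH"(2) * by simp
    ultimately show ?case using split[of F] split[of F'] F F' by simp
  qed (use letter in auto)
  then have "F X = F' X" if "X \<in> Arr ?Z" for X using that by (auto simp: C.zz_Arr)
  then show "F = F'" using F F' extensionalityI by blast
qed

end

lemma is_functor_comp: "is_functor A B F \<Longrightarrow> is_functor B C G \<Longrightarrow> is_functor A C (\<lambda>a. G (F a))"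
  unfolding is_functor_def by metis

lemma is_functor_restrict:
  assumes "category A" "is_functor A B F"
  shows "is_functor A B (restrict F (Arr A))"
proof -
  interpret category A by fact
  show ?thesis
    using assms(2) src_closed rng_closed cmp_closed by (auto simp: is_functor_def)
qed

lemma universal_atD:
  fixes H :: "'h cat"
  assumes "universal_at TYPE('h) C G i" "groupoid H" "is_functor C H f"
  shows "\<exists>!F. F \<in> extensional (Arr G) \<and> is_functor G H F \<and> (\<forall>a \<in> Arr C. F (i a) = f a)"
  using assms by (simp add: universal_at_def)

lemma universal_at_obtain:
  fixes H :: "'h cat"
  assumes "universal_at TYPE('h) C G i" "groupoid H" "is_functor C H f"
  obtains F where "is_functor G H F" "\<forall>a \<in> Arr C. F (i a) = f a"
  using ex1_implies_ex[OF universal_atD[OF assms]] by auto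

lemma universal_at_unique:
  fixes G :: "'g cat" and H :: "'h cat"
  assumes "universal_at TYPE('h) C G i" "groupoid H" "category G"
    and i: "is_functor C G i" and F: "is_functor G H F" and F': "is_functor G H F'"
    and eq: "\<And>a. a \<in> Arr C \<Longrightarrow> F (i a) = F' (i a)" and g: "g \<in> Arr G"
  shows "F g = F' g"
proof -
  let ?P = "\<lambda>K. K \<in> extensional (Arr G) \<and> is_functor G H K \<and> (\<forall>a \<in> Arr C. K (i a) = F (i a))"
  have 1: "\<exists>!K. ?P K"
    by (rule universal_atD[OF assms(1,2) is_functor_comp[OF i F]])
  have ia: "i a \<in> Arr G" if "a \<in> Arr C" for a using i that by (auto simp: is_functor_def)
  have "?P (restrict F (Arr G))" "?P (restrict F' (Arr G))"
    using is_functor_restrict[OF assms(3)] F F' eq ia by simp_all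
  with 1 have "restrict F (Arr G) = restrict F' (Arr G)" by blast
  then show ?thesis using g by (metis restrict_apply')
qed

lemma zz_universal:
  fixes C :: "('a, 'z) cat_scheme"
  assumes "category C"
  shows "universal_at TYPE('h) C (zz_groupoid C) (zz_incl C)"
  unfolding universal_at_def
proof (intro allI impI)
  fix H :: "'h cat" and f
  assume *: "groupoid H \<and> is_functor C H f"
  interpret zz_test C H f
    using * assms by (simp add: zz_test_def zz_test_axioms_def)
  show "\<exists>!F. F \<in> extensional (Arr (zz_groupoid C)) \<and> is_functor (zz_groupoid C) H F \<and>
      (\<forall>a \<in> Arr C. F (zz_incl C a) = f a)"
    by (rule universal)
qed

theorem fundamental_groupoid_exists:
  "category C \<Longrightarrow> fundamental_groupoid C (zz_groupoid C) (zz_incl C)"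
  unfolding fundamental_groupoid_def
  by (simp add: category.groupoid_zz category.zz_incl_functor category.zz_incl_Obj zz_universal)

theorem fundamental_groupoid_universal:
  fixes C :: "('a, 'z) cat_scheme" and G :: "'g cat"
  assumes C: "category C" and G: "fundamental_groupoid C G i"
  shows "universal_at TYPE('h) C G i"
  unfolding universal_at_def
proof (intro allI impI)
  let ?Z = "zz_groupoid C"
  fix K :: "'h cat" and f
  assume K: "groupoid K \<and> is_functor C K f"
  have gG: "groupoid G" "is_functor C G i"
    and uG: "universal_at TYPE('g) C G i" "universal_at TYPE(('a \<times> bool) list set) C G i"
    using G by (auto simp: fundamental_groupoid_def)
  have cG: "category G" using gG by (simp add: groupoid_def)
  have Z: "groupoid ?Z" "is_functor C ?Z (zz_incl C)" "category ?Z"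
    using category.groupoid_zz[OF C] category.zz_incl_functor[OF C] category.category_zz[OF C] by auto
  obtain F where F: "is_functor G ?Z F" "\<forall>a \<in> Arr C. F (i a) = zz_incl C a"
    by (rule universal_at_obtain[OF uG(2) Z(1,2)])
  obtain J where J: "is_functor ?Z G J" "\<forall>a \<in> Arr C. J (zz_incl C a) = i a"
    by (rule universal_at_obtain[OF zz_universal[OF C] gG])
  have i: "i a \<in> Arr G" if "a \<in> Arr C" for a using gG that by (auto simp: is_functor_def)
  have z: "zz_incl C a \<in> Arr ?Z" if "a \<in> Arr C" for a using Z that by (auto simp: is_functor_def)
  have JF: "J (F g) = g" if g: "g \<in> Arr G" for g
  proof -
    have id: "is_functor G G (\<lambda>g. g)" by (simp add: is_functor_def)
    show ?thesis
      using F J by (intro universal_at_unique[OF uG(1) gG(1) cG gG(2)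
        is_functor_comp[OF F(1) J(1)] id _ g]) simp
  qed
  obtain f' where f': "is_functor ?Z K f'" "\<forall>a \<in> Arr C. f' (zz_incl C a) = f a"
    by (rule universal_at_obtain[OF zz_universal[OF C]]) (use K in auto)
  show "\<exists>!H. H \<in> extensional (Arr G) \<and> is_functor G K H \<and> (\<forall>a \<in> Arr C. H (i a) = f a)"
  proof (rule ex_ex1I)
    show "\<exists>H. H \<in> extensional (Arr G) \<and> is_functor G K H \<and> (\<forall>a \<in> Arr C. H (i a) = f a)"
      using is_functor_restrict[OF cG is_functor_comp[OF F(1) f'(1)]] F f' i
      by (intro exI[of _ "restrict (\<lambda>g. f' (F g)) (Arr G)"]) auto
  next
    fix H H'
    assume H: "H \<in> extensional (Arr G) \<and> is_functor G K H \<and> (\<forall>a \<in> Arr C. H (i a) = f a)"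
      and H': "H' \<in> extensional (Arr G) \<and> is_functor G K H' \<and> (\<forall>a \<in> Arr C. H' (i a) = f a)"
    have fH: "is_functor G K H" "is_functor G K H'" using H H' by auto
    have eq: "H (J (zz_incl C a)) = H' (J (zz_incl C a))" if "a \<in> Arr C" for a
      using that H H' J(2) by simp
    have JX: "H (J X) = H' (J X)" if "X \<in> Arr ?Z" for X
      by (rule universal_at_unique[OF zz_universal[OF C] conjunct1[OF K] Z(3,2)
        is_functor_comp[OF J(1) fH(1)] is_functor_comp[OF J(1) fH(2)] eq that])
    show "H = H'"
    proof (rule extensionalityI)
      show "H \<in> extensional (Arr G)" "H' \<in> extensional (Arr G)" using H H' by blast+
      fix g assume g: "g \<in> Arr G"
      then have "F g \<in> Arr ?Z" using F(1) by (simp add: is_functor_def)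
      from JX[OF this] show "H g = H' g" by (simp add: JF[OF g])
    qed
  qed
qed

lemma induced_functor:
  fixes Om :: "('o, 'y) cat_scheme" and L :: "('l, 'z) cat_scheme"
    and G :: "'g cat" and H :: "'h cat"
  assumes "category Om" "is_functor Om L p"
    and "fundamental_groupoid Om G i" "fundamental_groupoid L H j"
  shows "is_functor G H (induced Om G i H j p)"
    and "\<And>a. a \<in> Arr Om \<Longrightarrow> induced Om G i H j p (i a) = j (p a)"
proof -
  have *: "groupoid H" "is_functor Om H (\<lambda>a. j (p a))"
    using assms is_functor_comp[of Om L p H j] by (simp_all add: fundamental_groupoid_def)
  from theI'[OF universal_atD[OF fundamental_groupoid_universal[OF assms(1,3)] *], folded induced_def]
  show "is_functor G H (induced Om G i H j p)"
    and "\<And>a. a \<in> Arr Om \<Longrightarrow> induced Om G i H j p (i a) = j (p a)" by auto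
qed

end

theory Submission
  imports Defs
begin

text \<open>
  The functor \<open>p\<^sub>*\<close> between the fundamental groupoids is itself a covering of groupoids: an arrow of
  \<open>\<G>(\<Lambda>)\<close> lifts to an arrow of \<open>\<G>(\<Omega>)\<close> with a prescribed source, and the range of the lift is
  determined. Lifts exist because the arrows of \<open>\<Lambda>\<close> generate \<open>\<G>(\<Lambda>)\<close>. Ranges are determined because
  the transport of fibres is a functor from \<open>\<Lambda>\<close> to the groupoid of partial bijections of the
  vertices of \<open>\<Omega>\<close>, and so extends to \<open>\<G>(\<Lambda>)\<close>.
  Lifting a loop \<open>g\<close> at \<open>x\<close> from \<open>v\<close> to \<open>w\<close> conjugates the image of the fundamental group at \<open>v\<close>
  into the one at \<open>w\<close>, which gives (1); lifting the projections of paths from \<open>v\<close> gives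
  the morphism in (2). A morphism is determined by its value at one vertex, whence (3).
\<close>

section \<open>Functors and calculations in groupoids\<close>

lemma is_functorD:
  assumes "is_functor C D F"
  shows "a \<in> Arr C \<Longrightarrow> F a \<in> Arr D"
    and "a \<in> Arr C \<Longrightarrow> src D (F a) = F (src C a)"
    and "a \<in> Arr C \<Longrightarrow> rng D (F a) = F (rng C a)"
    and "\<lbrakk>a \<in> Arr C; b \<in> Arr C; src C a = rng C b\<rbrakk> \<Longrightarrow> F (a \<cdot>\<^bsub>C\<^esub> b) = F a \<cdot>\<^bsub>D\<^esub> F b"
  using assms by (auto simp: is_functor_def)

text \<open>\<open>ginv\<close> is a choice by \<open>SOME\<close>, so its preservation rests on
  uniqueness of inverses: the image of an inverse is a left inverse of \<open>F g\<close> with the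
  right ends.\<close>

lemma functor_ginv:
  assumes "groupoid G" "groupoid H" "is_functor G H F" "g \<in> Arr G"
  shows "F (ginv G g) = ginv H (F g)"
proof -
  interpret G: groupoid G by fact
  interpret H: groupoid H by fact
  note F = is_functorD[OF assms(3)] and g = G.ginv[OF assms(4)]
  have Fg: "F g \<in> Arr H" using F assms(4) by blast
  show ?thesis
  proof (rule H.inverse_unique[OF Fg])
    show "F (ginv G g) \<cdot>\<^bsub>H\<^esub> F g = src H (F g)"
      using F(4)[OF g(1) assms(4) g(2)] g(5) F(2)[OF assms(4)] by simp
    show "F (ginv G g) \<in> Arr H" "src H (F (ginv G g)) = rng H (F g)"
      "rng H (F (ginv G g)) = src H (F g)"
      using F(1)[OF g(1)] F(2)[OF g(1)] F(3)[OF g(1)] F(2,3)[OF assms(4)] g(2,3) by simp_all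
  qed (rule H.ginv[OF Fg])+
qed

lemma (in category) Obj_iff: "v \<in> Obj C \<longleftrightarrow> v \<in> Arr C \<and> src C v = v \<and> rng C v = v"
  using rng_src[of v] by (auto simp: Obj_def)

lemma (in category) src_Obj: "a \<in> Arr C \<Longrightarrow> src C a \<in> Obj C"
  and rng_Obj: "a \<in> Arr C \<Longrightarrow> rng C a \<in> Obj C"
  by (simp_all add: Obj_def src_closed rng_closed src_src src_rng)

lemma (in category) functor_Obj:
  assumes "is_functor C D F" "v \<in> Obj C"
  shows "F v \<in> Obj D"
  using is_functorD(1,2)[OF assms(1), of v] assms(2) by (simp add: Obj_def)

lemma (in groupoid) cancel_left:
  assumes "a \<in> Arr C" "b \<in> Arr C" "src C a = rng C b"
  shows "ginv C a \<cdot> (a \<cdot> b) = b"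
  using assms ginv[of a] cmp_assoc[of "ginv C a" a b] rng_cmp_left[of b] by simp

lemma (in groupoid) ginv_ginv:
  assumes "a \<in> Arr C"
  shows "ginv C (ginv C a) = a"
  by (rule inverse_unique[of "ginv C a"])
    (use ginv[OF assms] ginv[of "ginv C a"] assms in auto)

lemma (in groupoid) cancel_left':
  assumes "a \<in> Arr C" "b \<in> Arr C" "rng C a = rng C b"
  shows "a \<cdot> (ginv C a \<cdot> b) = b"
  using cancel_left[of "ginv C a" b] ginv[OF assms(1)] assms ginv_ginv[of a] by simp

text \<open>Conjugation by \<open>h\<close> is undone by conjugation by \<open>ginv C h\<close>, so
  it is onto the loops at the other end. Applying \<open>pstar\<close> to this equation later gives
  the conjugacy of images in (1).\<close>

lemma (in groupoid) loops_conjugate: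
  assumes h: "h \<in> Arr C"
  shows "{m \<in> Arr C. rng C m = rng C h \<and> src C m = rng C h} =
    (\<lambda>n. h \<cdot> (n \<cdot> ginv C h)) ` {n \<in> Arr C. rng C n = src C h \<and> src C n = src C h}"
    (is "?M = ?f ` ?N")
proof
  note h' = ginv[OF h]
  show "?M \<subseteq> ?f ` ?N"
  proof
    fix m assume m: "m \<in> ?M"
    let ?n = "ginv C h \<cdot> (m \<cdot> h)"
    have mh: "m \<cdot> h \<in> Arr C" "rng C (m \<cdot> h) = rng C h" "src C (m \<cdot> h) = src C h"
      using m h cmp_closed rng_cmp src_cmp by auto
    then have n: "?n \<in> ?N" using h h' cmp_closed rng_cmp src_cmp by auto
    have "?n \<cdot> ginv C h = ginv C h \<cdot> (m \<cdot> (h \<cdot> ginv C h))"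
      using m mh h h' cmp_assoc[of "ginv C h" "m \<cdot> h" "ginv C h"] cmp_assoc[of m h "ginv C h"]
      by simp
    also have "\<dots> = ginv C h \<cdot> m" using m h' cmp_src[of m] by simp
    finally have "m = ?f ?n" using cancel_left'[OF h, of m] m by simp
    with n show "m \<in> ?f ` ?N" by blast
  qed
  show "?f ` ?N \<subseteq> ?M"
    using h h' cmp_closed rng_cmp src_cmp by auto
qed

section \<open>Fundamental groups\<close>

lemma fundamental_group_simps [simp]:
  "carrier (fundamental_group G i x) = {g \<in> Arr G. rng G g = i x \<and> src G g = i x}"
  "mult (fundamental_group G i x) = cmp G"
  "one (fundamental_group G i x) = i x"
  by (simp_all add: fundamental_group_def)

lemma group_fundamental_group:
  assumes "groupoid G" "i x \<in> Obj G"
  shows "group (fundamental_group G i x)"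
proof -
  interpret groupoid G by fact
  show ?thesis
  proof (rule groupI)
    fix g assume "g \<in> carrier (fundamental_group G i x)"
    then show "\<exists>h \<in> carrier (fundamental_group G i x).
        h \<otimes>\<^bsub>fundamental_group G i x\<^esub> g = \<one>\<^bsub>fundamental_group G i x\<^esub>"
      using ginv[of g] by (intro bexI[of _ "ginv G g"]) auto
    show "\<one>\<^bsub>fundamental_group G i x\<^esub> \<otimes>\<^bsub>fundamental_group G i x\<^esub> g = g"
      using \<open>g \<in> _\<close> rng_cmp_left[of g] by auto
  qed (use assms(2) cmp_closed src_cmp rng_cmp cmp_assoc in \<open>auto simp: Obj_iff\<close>)
qed

lemma inv_fundamental_group:
  assumes "groupoid G" "i x \<in> Obj G" "g \<in> carrier (fundamental_group G i x)"
  shows "inv\<^bsub>fundamental_group G i x\<^esub> g = ginv G g"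
  using group.inv_equality[OF group_fundamental_group[of G i x], of "ginv G g" g]
    groupoid.ginv[of G g] assms by auto

section \<open>Induction over a fundamental groupoid\<close>

lemma fundamental_groupoid_induct [consumes 2, case_names incl cmp ginv]:
  fixes G :: "'g cat"
  assumes fG: "fundamental_groupoid C G i" and g: "g \<in> Arr G"
    and incl: "\<And>a. a \<in> Arr C \<Longrightarrow> P (i a)"
    and cmp: "\<And>a b. \<lbrakk>a \<in> Arr G; b \<in> Arr G; src G a = rng G b; P a; P b\<rbrakk> \<Longrightarrow> P (a \<cdot>\<^bsub>G\<^esub> b)"
    and inv: "\<And>a. \<lbrakk>a \<in> Arr G; P a\<rbrakk> \<Longrightarrow> P (ginv G a)"
  shows "P g"
proof -
  have i: "is_functor C G i" and uG: "universal_at TYPE('g) C G i" and gG: "groupoid G"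
    using fG by (auto simp: fundamental_groupoid_def)
  interpret groupoid G by fact
  txt \<open>By uniqueness in the universal property, the functor from \<open>G\<close> to the subgroupoid of the
    arrows satisfying \<open>P\<close> that extends \<open>i\<close> is the identity.\<close>
  let ?S = "G\<lparr>Arr := {g \<in> Arr G. P g}\<rparr>"
  \<comment> \<open>Identities satisfy \<open>P\<close> because they are products of an arrow with
    its inverse.\<close>
  have P: "P (src G a)" "P (rng G a)" if "a \<in> Arr G" "P a" for a
    using cmp[of "ginv G a" a] cmp[of a "ginv G a"] inv[of a] that
    by (simp_all add: ginv)
  have S: "groupoid ?S"
  proof
    fix a assume "a \<in> Arr ?S"
    then have "a \<in> Arr G" "P a" by auto
    then show "\<exists>b \<in> Arr ?S. src ?S b = rng ?S a \<and> rng ?S b = src ?S a \<and>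
        a \<cdot>\<^bsub>?S\<^esub> b = rng ?S a \<and> b \<cdot>\<^bsub>?S\<^esub> a = src ?S a"
      using ginv[of a] inv by (intro bexI[of _ "ginv G a"]) auto
  qed (auto simp: P src_closed rng_closed src_src rng_src src_rng rng_rng cmp_closed src_cmp
      rng_cmp cmp_src rng_cmp_left cmp_assoc intro: cmp)
  \<comment> \<open>The subgroupoid has the arrow type of \<open>G\<close> itself, so the universal
    property at \<open>TYPE('g)\<close> applies to it.\<close>
  have "is_functor C ?S i" using i incl by (auto simp: is_functor_def)
  then obtain F where F: "is_functor G ?S F" "\<forall>a \<in> Arr C. F (i a) = i a"
    by (rule universal_at_obtain[OF uG S])
  have "is_functor G G F" "is_functor G G (\<lambda>a. a)" using F by (auto simp: is_functor_def)
  then have "F g = g"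
    by (rule universal_at_unique[OF uG gG category_axioms i]) (use F(2) g in auto)
  then show ?thesis using is_functorD(1)[OF F(1) g] by simp
qed

section \<open>The groupoid of partial bijections\<close>

text \<open>Partial bijections are represented by their graphs, as sets of pairs (argument, value).\<close>

definition partial_bijections :: "('a \<times> 'a) set cat" where
  "partial_bijections =
     \<lparr>Arr = {R. single_valued R \<and> single_valued (R\<inverse>)},
      src = (\<lambda>R. Id_on (Domain R)), rng = (\<lambda>R. Id_on (Range R)), cmp = (\<lambda>R S. S O R)\<rparr>"

lemma partial_bijections_simps [simp]:
  "R \<in> Arr partial_bijections \<longleftrightarrow> single_valued R \<and> single_valued (R\<inverse>)"
  "src partial_bijections R = Id_on (Domain R)"
  "rng partial_bijections R = Id_on (Range R)"
  "R \<cdot>\<^bsub>partial_bijections\<^esub> S = S O R"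
  by (simp_all add: partial_bijections_def)

lemma Id_on_eq_iff [simp]: "Id_on A = Id_on B \<longleftrightarrow> A = B"
  by (metis Domain_Id_on)

lemma partial_bijections_inverse:
  assumes "R \<in> Arr partial_bijections"
  shows "R O R\<inverse> = Id_on (Domain R)" "R\<inverse> O R = Id_on (Range R)"
  using assms by (auto simp: single_valued_def Id_on_iff)

text \<open>The inverse is the converse relation. The product \<open>S O R\<close> applies
  \<open>S\<close> first, and composability says that the domain of \<open>R\<close> is the range of
  \<open>S\<close>, so no point is lost in a composite.\<close>

lemma groupoid_partial_bijections: "groupoid partial_bijections"
proof
  fix R :: "('a \<times> 'a) set"
  assume R: "R \<in> Arr partial_bijections"
  then show "\<exists>S \<in> Arr partial_bijections.
      src partial_bijections S = rng partial_bijections R \<and>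
      rng partial_bijections S = src partial_bijections R \<and>
      R \<cdot>\<^bsub>partial_bijections\<^esub> S = rng partial_bijections R \<and>
      S \<cdot>\<^bsub>partial_bijections\<^esub> R = src partial_bijections R"
    by (intro bexI[of _ "R\<inverse>"]) (simp_all add: partial_bijections_inverse)
  show "R \<cdot>\<^bsub>partial_bijections\<^esub> src partial_bijections R = R"
    "rng partial_bijections R \<cdot>\<^bsub>partial_bijections\<^esub> R = R" by auto
next
  fix R S :: "('a \<times> 'a) set"
  assume RS: "R \<in> Arr partial_bijections" "S \<in> Arr partial_bijections"
    "src partial_bijections R = rng partial_bijections S"
  then have dom: "Domain R = Range S" by simp
  show "R \<cdot>\<^bsub>partial_bijections\<^esub> S \<in> Arr partial_bijections"
    using RS by (simp add: converse_relcomp single_valued_relcomp)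
  have "Domain (S O R) = Domain S" using dom by blast
  moreover have "Range (S O R) = Range R" using dom by blast
  ultimately show "src partial_bijections (R \<cdot>\<^bsub>partial_bijections\<^esub> S) = src partial_bijections S"
    "rng partial_bijections (R \<cdot>\<^bsub>partial_bijections\<^esub> S) = rng partial_bijections R"
    by simp_all
qed (auto simp: single_valued_def)

lemma ginv_partial_bijections:
  assumes "R \<in> Arr partial_bijections"
  shows "ginv partial_bijections R = R\<inverse>"
proof -
  interpret groupoid "partial_bijections :: ('a \<times> 'a) set cat" by (rule groupoid_partial_bijections)
  show ?thesis
    by (rule inverse_unique[OF assms])
      (use assms ginv[OF assms] in \<open>simp_all add: partial_bijections_inverse\<close>)
qed

section \<open>A connected covering and its lifting of arrows\<close>

text \<open>The groupoids are arbitrary models of the universal property, not the zigzag model;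
  their objects are reached only through the bijections \<open>j\<close> and
  \<open>i\<close>.\<close>

locale fundamental_covering =
  fixes k :: nat and L :: "('l, 'y) kgraph_scheme" and Om :: "('o, 'z) kgraph_scheme"
    and p :: "'o \<Rightarrow> 'l" and GL :: "'h cat" and j :: "'l \<Rightarrow> 'h" and GO :: "'g cat" and i :: "'o \<Rightarrow> 'g"
  assumes connected_covering: "connected_covering k L Om p"
    and fundamental_L: "fundamental_groupoid L GL j"
    and fundamental_Om: "fundamental_groupoid Om GO i"
begin

lemma covering: "covering k L Om p"
  using connected_covering by (simp add: connected_covering_def)

sublocale L: kgraph k L
  using covering by (simp add: covering_def)

sublocale Om: kgraph k Om
  using covering by (simp add: covering_def)

sublocale GL: groupoid GL
  using fundamental_L by (simp add: fundamental_groupoid_def)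

sublocale GO: groupoid GO
  using fundamental_Om by (simp add: fundamental_groupoid_def)

abbreviation pstar :: "'g \<Rightarrow> 'h" where
  "pstar \<equiv> induced Om GO i GL j p"

abbreviation pimage :: "'o \<Rightarrow> 'h set" where
  "pimage \<equiv> induced_image Om GO i GL j p"

lemma p_functor: "is_functor Om L p" and deg_p: "a \<in> Arr Om \<Longrightarrow> deg L (p a) = deg Om a"
  using covering by (simp_all add: covering_def kgraph_morphism_def)

lemmas p = is_functorD[OF p_functor]

lemma j_functor: "is_functor L GL j" and i_functor: "is_functor Om GO i"
  using fundamental_L fundamental_Om by (simp_all add: fundamental_groupoid_def)

lemmas i = is_functorD[OF i_functor]
lemmas j = is_functorD[OF j_functor]

lemma p_Obj: "v \<in> Obj Om \<Longrightarrow> p v \<in> Obj L"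
  by (rule Om.functor_Obj[OF p_functor])

lemma i_inj: "\<lbrakk>v \<in> Obj Om; w \<in> Obj Om; i v = i w\<rbrakk> \<Longrightarrow> v = w"
  using fundamental_Om by (auto simp: fundamental_groupoid_def bij_betw_def inj_on_def)

lemma j_inj: "\<lbrakk>v \<in> Obj L; w \<in> Obj L; j v = j w\<rbrakk> \<Longrightarrow> v = w"
  using fundamental_L by (auto simp: fundamental_groupoid_def bij_betw_def inj_on_def)

lemma i_surj:
  assumes "g \<in> Obj GO"
  obtains v where "v \<in> Obj Om" "i v = g"
proof -
  have "g \<in> i ` Obj Om"
    using assms fundamental_Om by (simp add: fundamental_groupoid_def bij_betw_def)
  then show ?thesis using that by blast
qed

lemma pstar_functor: "is_functor GO GL pstar"
  and pstar_incl: "a \<in> Arr Om \<Longrightarrow> pstar (i a) = j (p a)"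
  using induced_functor[OF Om.category_axioms p_functor fundamental_Om fundamental_L] by blast+

lemmas pstar = is_functorD[OF pstar_functor]

lemma pstar_ginv: "h \<in> Arr GO \<Longrightarrow> pstar (ginv GO h) = ginv GL (pstar h)"
  by (rule functor_ginv[OF GO.groupoid_axioms GL.groupoid_axioms pstar_functor])

lemma pstar_Obj: "v \<in> Obj Om \<Longrightarrow> pstar (i v) = j (p v)"
  by (simp add: pstar_incl Obj_def)

lemma lift_from_source:
  assumes "v \<in> Obj Om" "b \<in> Arr L" "src L b = p v"
  obtains a where "a \<in> Arr Om" "src Om a = v" "p a = b"
proof -
  have "bij_betw p {a \<in> Arr Om. src Om a = v} {b \<in> Arr L. src L b = p v}"
    using covering assms(1) by (simp add: covering_def)
  then have "b \<in> p ` {a \<in> Arr Om. src Om a = v}" using assms by (simp add: bij_betw_def)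
  then show ?thesis using that by auto
qed

lemma lift_from_range:
  assumes "v \<in> Obj Om" "b \<in> Arr L" "rng L b = p v"
  obtains a where "a \<in> Arr Om" "rng Om a = v" "p a = b"
proof -
  have "bij_betw p {a \<in> Arr Om. rng Om a = v} {b \<in> Arr L. rng L b = p v}"
    using covering assms(1) by (simp add: covering_def)
  then have "b \<in> p ` {a \<in> Arr Om. rng Om a = v}" using assms by (simp add: bij_betw_def)
  then show ?thesis using that by auto
qed

lemma lift_unique:
  assumes "a \<in> Arr Om" "b \<in> Arr Om" "p a = p b" "src Om a = src Om b"
  shows "a = b"
proof -
  have "inj_on p {c \<in> Arr Om. src Om c = src Om a}"
    using covering Om.src_Obj[OF assms(1)] by (auto simp: covering_def bij_betw_def)
  then show ?thesis using assms by (auto dest: inj_onD)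
qed

lemma lift_unique_range:
  assumes "a \<in> Arr Om" "b \<in> Arr Om" "p a = p b" "rng Om a = rng Om b"
  shows "a = b"
proof -
  have "inj_on p {c \<in> Arr Om. rng Om c = rng Om a}"
    using covering Om.rng_Obj[OF assms(1)] by (auto simp: covering_def bij_betw_def)
  then show ?thesis using assms by (auto dest: inj_onD)
qed

text \<open>Surjectivity of \<open>p\<close> gives an arrow over \<open>x\<close>; its source is a
  vertex and lies over \<open>src L x = x\<close>.\<close>

lemma fibre_nonempty:
  assumes "x \<in> Obj L"
  obtains v where "v \<in> Obj Om" "p v = x"
proof -
  have x: "x \<in> Arr L" "src L x = x" using assms by (auto simp: Obj_def)
  have "x \<in> p ` Arr Om" using covering x(1) by (simp add: covering_def)
  then obtain a where a: "a \<in> Arr Om" "p a = x" by blast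
  show ?thesis
  proof (rule that)
    show "src Om a \<in> Obj Om" by (rule Om.src_Obj[OF a(1)])
    show "p (src Om a) = x" using p(2)[OF a(1)] a(2) x(2) by metis
  qed
qed

section \<open>Transport of fibres as a functor\<close>

text \<open>This is the monodromy of \<open>a\<close>. Unique lifting from sources and from ranges
  makes it the graph of a bijection from the fibre over \<open>src L a\<close> to the fibre over
  \<open>rng L a\<close>.\<close>

definition transport :: "'l \<Rightarrow> ('o \<times> 'o) set" where
  "transport a = {(src Om b, rng Om b) | b. b \<in> Arr Om \<and> p b = a}"

lemma transport_iff: "(v, w) \<in> transport a \<longleftrightarrow> (\<exists>b \<in> Arr Om. p b = a \<and> v = src Om b \<and> w = rng Om b)"
  by (auto simp: transport_def)

lemma Domain_transport:
  assumes "a \<in> Arr L"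
  shows "Domain (transport a) = fibre Om p (src L a)"
proof (intro Set.set_eqI iffI)
  fix v assume "v \<in> Domain (transport a)"
  then show "v \<in> fibre Om p (src L a)"
    using p(2) Om.src_Obj by (auto simp: Domain_iff transport_iff fibre_def)
next
  fix v assume "v \<in> fibre Om p (src L a)"
  then have v: "v \<in> Obj Om" "p v = src L a" by (auto simp: fibre_def)
  obtain b where "b \<in> Arr Om" "src Om b = v" "p b = a"
    by (rule lift_from_source[OF v(1) assms v(2)[symmetric]])
  then show "v \<in> Domain (transport a)" by (auto simp: Domain_iff transport_iff)
qed

lemma Range_transport:
  assumes "a \<in> Arr L"
  shows "Range (transport a) = fibre Om p (rng L a)"
proof (intro Set.set_eqI iffI)
  fix v assume "v \<in> Range (transport a)"
  then show "v \<in> fibre Om p (rng L a)"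
    using p(3) Om.rng_Obj by (auto simp: Range_iff transport_iff fibre_def)
next
  fix v assume "v \<in> fibre Om p (rng L a)"
  then have v: "v \<in> Obj Om" "p v = rng L a" by (auto simp: fibre_def)
  obtain b where "b \<in> Arr Om" "rng Om b = v" "p b = a"
    by (rule lift_from_range[OF v(1) assms v(2)[symmetric]])
  then show "v \<in> Range (transport a)" by (auto simp: Range_iff transport_iff)
qed

lemma transport_partial_bijection: "transport a \<in> Arr partial_bijections"
proof -
  have "single_valued (transport a)"
  proof (rule single_valuedI)
    fix v w w' assume "(v, w) \<in> transport a" "(v, w') \<in> transport a"
    then obtain b b' where "b \<in> Arr Om" "b' \<in> Arr Om" "p b = p b'" "src Om b = src Om b'"
      "w = rng Om b" "w' = rng Om b'" by (auto simp: transport_iff)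
    then show "w = w'" using lift_unique[of b b'] by simp
  qed
  moreover have "single_valued ((transport a)\<inverse>)"
  proof (rule single_valuedI)
    fix v w w' assume "(v, w) \<in> (transport a)\<inverse>" "(v, w') \<in> (transport a)\<inverse>"
    then obtain b b' where "b \<in> Arr Om" "b' \<in> Arr Om" "p b = p b'" "rng Om b = rng Om b'"
      "w = src Om b" "w' = src Om b'" by (auto simp: transport_iff)
    then show "w = w'" using lift_unique_range[of b b'] by simp
  qed
  ultimately show ?thesis by simp
qed

lemma transport_Obj:
  assumes "x \<in> Obj L"
  shows "transport x = Id_on (fibre Om p x)"
proof -
  have x: "x \<in> Arr L" "src L x = x" using assms by (auto simp: Obj_def)
  \<comment> \<open>An arrow over a vertex is a vertex: \<open>b\<close> and \<open>src Om b\<close>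
    have the same projection and the same source.\<close>
  have id: "src Om b = b" "rng Om b = b" if b: "b \<in> Arr Om" "p b = x" for b
  proof -
    have "p b = p (src Om b)" using p(2)[OF b(1)] b(2) x(2) by metis
    from lift_unique[OF b(1) Om.src_closed[OF b(1)] this] show "src Om b = b"
      using Om.src_src[OF b(1)] by metis
    then show "rng Om b = b" using Om.rng_src[OF b(1)] by simp
  qed
  show ?thesis
  proof (intro Set.set_eqI iffI)
    fix e assume "e \<in> transport x"
    then obtain b where b: "b \<in> Arr Om" "p b = x" "e = (src Om b, rng Om b)"
      by (auto simp: transport_def)
    then show "e \<in> Id_on (fibre Om p x)" using id[OF b(1,2)] by (auto simp: fibre_def Obj_def)
  next
    fix e assume "e \<in> Id_on (fibre Om p x)"
    then obtain v where v: "v \<in> Arr Om" "p v = x" "e = (v, v)"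
      by (auto simp: fibre_def Obj_def)
    then show "e \<in> transport x"
      using id[OF v(1,2)] by (auto simp: transport_iff intro!: bexI[of _ v])
  qed
qed

lemma transport_cmp:
  assumes ab: "a \<in> Arr L" "b \<in> Arr L" "src L a = rng L b"
  shows "transport (a \<cdot>\<^bsub>L\<^esub> b) = transport b O transport a"
proof (intro Set.set_eqI iffI)
  fix e assume "e \<in> transport (a \<cdot>\<^bsub>L\<^esub> b)"
  then obtain c where c: "c \<in> Arr Om" "p c = a \<cdot>\<^bsub>L\<^esub> b" "e = (src Om c, rng Om c)"
    by (auto simp: transport_def)
  have pc: "p (src Om c) = src L b" using p(2)[OF c(1)] c(2) L.src_cmp[OF ab] by simp
  obtain b' where b': "b' \<in> Arr Om" "src Om b' = src Om c" "p b' = b"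
    using lift_from_source[OF Om.src_Obj[OF c(1)] ab(2)] pc by metis
  have "src L a = p (rng Om b')" using p(3)[OF b'(1)] b'(3) ab(3) by simp
  then obtain a' where a': "a' \<in> Arr Om" "src Om a' = rng Om b'" "p a' = a"
    using lift_from_source[OF Om.rng_Obj[OF b'(1)] ab(1)] by metis
  \<comment> \<open>Both sides lift the composite of \<open>a\<close> and \<open>b\<close> and start
    at \<open>src Om c\<close>, so uniqueness of lifts identifies them.\<close>
  have "c = a' \<cdot>\<^bsub>Om\<^esub> b'"
    using c a' b' p(4)[OF a'(1) b'(1) a'(2)] Om.cmp_closed[OF a'(1) b'(1) a'(2)]
      Om.src_cmp[OF a'(1) b'(1) a'(2)]
    by (intro lift_unique[of c]) simp_all
  then have "rng Om c = rng Om a'" using Om.rng_cmp[OF a'(1) b'(1) a'(2)] by simp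
  moreover have "(src Om c, rng Om b') \<in> transport b" "(rng Om b', rng Om a') \<in> transport a"
    using a' b' unfolding transport_iff by metis+
  ultimately show "e \<in> transport b O transport a" using c(3) by auto
next
  fix e assume "e \<in> transport b O transport a"
  then obtain a' b' where a': "a' \<in> Arr Om" "p a' = a" and b': "b' \<in> Arr Om" "p b' = b"
    and e: "e = (src Om b', rng Om a')" "src Om a' = rng Om b'"
    by (auto simp: transport_def)
  note * = a'(1) b'(1) e(2)
  have "p (a' \<cdot>\<^bsub>Om\<^esub> b') = a \<cdot>\<^bsub>L\<^esub> b" using p(4)[OF *] a' b' by simp
  then show "e \<in> transport (a \<cdot>\<^bsub>L\<^esub> b)"
    using e(1) Om.cmp_closed[OF *] Om.src_cmp[OF *] Om.rng_cmp[OF *] by (auto simp: transport_iff)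
qed

lemma transport_functor: "is_functor L partial_bijections transport"
  unfolding is_functor_def
  using transport_partial_bijection
  by (auto simp: Domain_transport Range_transport transport_Obj transport_cmp L.src_Obj L.rng_Obj
      simp del: partial_bijections_simps(1))

section \<open>Lifting through the functor \<open>pstar\<close>\<close>

text \<open>Transport extends to a functor \<open>T\<close> on \<open>GL\<close>. The ends of every
  arrow \<open>h\<close> form a pair in \<open>T (pstar h)\<close>, and this relation is
  single-valued, so source and projection determine the range.\<close>

lemma range_lift_unique:
  assumes h: "h \<in> Arr GO" "h' \<in> Arr GO" "src GO h = src GO h'" "pstar h = pstar h'"
  shows "rng GO h = rng GO h'"
proof -
  \<comment> \<open>Sets of pairs of vertices need not be one of the two arrow types tested in the
    definition of a fundamental groupoid, hence the passage to test groupoids of any type.\<close>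
  obtain T where T: "is_functor GL partial_bijections T" "\<forall>a \<in> Arr L. T (j a) = transport a"
    using universal_at_obtain[OF fundamental_groupoid_universal[OF L.category_axioms fundamental_L]
        groupoid_partial_bijections transport_functor] by metis
  note TD = is_functorD[OF T(1)]
  have T_pstar: "\<exists>v \<in> Obj Om. \<exists>w \<in> Obj Om. src GO h = i v \<and> rng GO h = i w \<and> (v, w) \<in> T (pstar h)"
    if "h \<in> Arr GO" for h
    using fundamental_Om that
  proof (induction rule: fundamental_groupoid_induct)
    case (incl a)
    then show ?case
      using T(2) p(1)[OF incl] i(2,3)[OF incl] Om.src_Obj[OF incl] Om.rng_Obj[OF incl]
      by (auto simp: pstar_incl transport_iff)
  next
    case (cmp a b)
    then obtain u v w w' where *: "u \<in> Obj Om" "v \<in> Obj Om" "w \<in> Obj Om" "w' \<in> Obj Om"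
      "src GO b = i u" "rng GO b = i v" "src GO a = i w" "rng GO a = i w'"
      "(u, v) \<in> T (pstar b)" "(w, w') \<in> T (pstar a)" by blast
    \<comment> \<open>Composability in \<open>GO\<close> only gives \<open>i v = i w\<close>;
      injectivity of \<open>i\<close> on vertices makes the two pairs composable.\<close>
    then have "v = w" using cmp(3) i_inj by simp
    moreover have "T (pstar (a \<cdot>\<^bsub>GO\<^esub> b)) = T (pstar b) O T (pstar a)"
      using pstar(4)[OF cmp(1-3)] TD(4)[of "pstar a" "pstar b"] pstar(1-3) cmp(1-3) by simp
    ultimately have "(u, w') \<in> T (pstar (a \<cdot>\<^bsub>GO\<^esub> b))" using * by auto
    then show ?case
      using * GO.src_cmp[OF cmp(1-3)] GO.rng_cmp[OF cmp(1-3)] by auto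
  next
    case (ginv a)
    have "T (pstar (ginv GO a)) = (T (pstar a))\<inverse>"
      using functor_ginv[OF GL.groupoid_axioms groupoid_partial_bijections T(1) pstar(1)[OF ginv(1)]]
        ginv_partial_bijections[OF TD(1)[OF pstar(1)[OF ginv(1)]]]
      by (simp add: pstar_ginv[OF ginv(1)])
    then show ?case using ginv(2) GO.ginv(2,3)[OF ginv(1)] by auto
  qed
  obtain v w v' w' where *: "v \<in> Obj Om" "w \<in> Obj Om" "v' \<in> Obj Om" "w' \<in> Obj Om"
      "src GO h = i v" "rng GO h = i w" "src GO h' = i v'" "rng GO h' = i w'"
      "(v, w) \<in> T (pstar h)" "(v', w') \<in> T (pstar h')"
    using T_pstar[OF h(1)] T_pstar[OF h(2)] by blast
  have "v = v'" using * h(3) i_inj by simp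
  moreover have "single_valued (T (pstar h))" using TD(1) pstar(1)[OF h(1)] by simp
  ultimately show ?thesis using * h(4) by (auto dest: single_valuedD)
qed

lemma lift_exists:
  assumes "g \<in> Arr GL" "v \<in> Obj Om" "src GL g = j (p v)"
  shows "\<exists>h \<in> Arr GO. src GO h = i v \<and> pstar h = g"
proof -
  \<comment> \<open>Lifts with prescribed source and lifts with prescribed range are produced
    together, because the induction step for inverses exchanges them.\<close>
  have "(\<forall>v \<in> Obj Om. src GL g = j (p v) \<longrightarrow> (\<exists>h \<in> Arr GO. src GO h = i v \<and> pstar h = g)) \<and>
        (\<forall>v \<in> Obj Om. rng GL g = j (p v) \<longrightarrow> (\<exists>h \<in> Arr GO. rng GO h = i v \<and> pstar h = g))"
    using fundamental_L assms(1)
  proof (induction rule: fundamental_groupoid_induct)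
    case (incl a)
    show ?case
    proof (intro conjI ballI impI)
      fix v assume v: "v \<in> Obj Om" "src GL (j a) = j (p v)"
      then have "src L a = p v" using j(2)[OF incl] j_inj[OF L.src_Obj[OF incl] p_Obj] by simp
      then obtain b where "b \<in> Arr Om" "src Om b = v" "p b = a"
        using lift_from_source v(1) incl by metis
      then show "\<exists>h \<in> Arr GO. src GO h = i v \<and> pstar h = j a"
        using i(1,2)[of b] by (intro bexI[of _ "i b"]) (auto simp: pstar_incl)
    next
      fix v assume v: "v \<in> Obj Om" "rng GL (j a) = j (p v)"
      then have "rng L a = p v" using j(3)[OF incl] j_inj[OF L.rng_Obj[OF incl] p_Obj] by simp
      then obtain b where "b \<in> Arr Om" "rng Om b = v" "p b = a"
        using lift_from_range v(1) incl by metis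
      then show "\<exists>h \<in> Arr GO. rng GO h = i v \<and> pstar h = j a"
        using i(1,3)[of b] by (intro bexI[of _ "i b"]) (auto simp: pstar_incl)
    qed
  next
    case (cmp a b)
    show ?case
    proof (intro conjI ballI impI)
      fix v assume v: "v \<in> Obj Om" "src GL (a \<cdot>\<^bsub>GL\<^esub> b) = j (p v)"
      then obtain h where h: "h \<in> Arr GO" "src GO h = i v" "pstar h = b"
        using cmp(5) GL.src_cmp[OF cmp(1-3)] by auto
      \<comment> \<open>\<open>w\<close> is the vertex where the lift of \<open>b\<close> ends and
        the lift of \<open>a\<close> has to begin. When the range is prescribed instead,
        \<open>a\<close> is lifted first.\<close>
      obtain w where w: "w \<in> Obj Om" "i w = rng GO h" using i_surj GO.rng_Obj[OF h(1)] by metis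
      have "src GL a = j (p w)" using pstar_Obj[OF w(1)] w(2) pstar(3)[OF h(1)] h(3) cmp(3) by simp
      then obtain h' where h': "h' \<in> Arr GO" "src GO h' = rng GO h" "pstar h' = a"
        using cmp(4) w by auto
      show "\<exists>h \<in> Arr GO. src GO h = i v \<and> pstar h = a \<cdot>\<^bsub>GL\<^esub> b"
        using pstar(4)[OF h'(1) h(1) h'(2)] GO.src_cmp[OF h'(1) h(1) h'(2)] h h'
        by (intro bexI[OF _ GO.cmp_closed[OF h'(1) h(1) h'(2)]]) simp
    next
      fix v assume v: "v \<in> Obj Om" "rng GL (a \<cdot>\<^bsub>GL\<^esub> b) = j (p v)"
      then obtain h where h: "h \<in> Arr GO" "rng GO h = i v" "pstar h = a"
        using cmp(4) GL.rng_cmp[OF cmp(1-3)] by auto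
      obtain w where w: "w \<in> Obj Om" "i w = src GO h" using i_surj GO.src_Obj[OF h(1)] by metis
      have "rng GL b = j (p w)" using pstar_Obj[OF w(1)] w(2) pstar(2)[OF h(1)] h(3) cmp(3) by simp
      then obtain h' where h': "h' \<in> Arr GO" "rng GO h' = src GO h" "pstar h' = b"
        using cmp(5) w by auto
      note * = h(1) h'(1) h'(2)[symmetric]
      show "\<exists>h \<in> Arr GO. rng GO h = i v \<and> pstar h = a \<cdot>\<^bsub>GL\<^esub> b"
        using pstar(4)[OF *] GO.rng_cmp[OF *] h h'
        by (intro bexI[OF _ GO.cmp_closed[OF *]]) simp
    qed
  next
    case (ginv a)
    show ?case
    proof (intro conjI ballI impI)
      fix v assume v: "v \<in> Obj Om" "src GL (ginv GL a) = j (p v)"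
      then obtain h where h: "h \<in> Arr GO" "rng GO h = i v" "pstar h = a"
        using ginv GL.ginv(2)[OF ginv(1)] by auto
      then show "\<exists>h \<in> Arr GO. src GO h = i v \<and> pstar h = ginv GL a"
        using GO.ginv(2)[OF h(1)] by (intro bexI[OF _ GO.ginv(1)[OF h(1)]]) (simp add: pstar_ginv)
    next
      fix v assume v: "v \<in> Obj Om" "rng GL (ginv GL a) = j (p v)"
      then obtain h where h: "h \<in> Arr GO" "src GO h = i v" "pstar h = a"
        using ginv GL.ginv(3)[OF ginv(1)] by auto
      then show "\<exists>h \<in> Arr GO. rng GO h = i v \<and> pstar h = ginv GL a"
        using GO.ginv(3)[OF h(1)] by (intro bexI[OF _ GO.ginv(1)[OF h(1)]]) (simp add: pstar_ginv)
    qed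
  qed
  then show ?thesis using assms by blast
qed

text \<open>Connectedness gives a chain of arrows of \<open>Om\<close>; those pointing against the
  chain are traversed through their inverses in \<open>GO\<close>.\<close>

lemma connecting_arrow:
  assumes "v \<in> Obj Om" "w \<in> Obj Om"
  obtains h where "h \<in> Arr GO" "src GO h = i v" "rng GO h = i w"
proof -
  let ?E = "\<lambda>u v. {a \<in> Arr Om. rng Om a = u \<and> src Om a = v} \<noteq> {}"
  have "equivclp ?E v w"
    using connected_covering assms by (simp add: connected_covering_def connected_category_def)
  then have "\<exists>h \<in> Arr GO. src GO h = i v \<and> rng GO h = i w"
  proof (induction rule: equivclp_induct)
    case base
    have "i v \<in> Obj GO" by (rule Om.functor_Obj[OF i_functor assms(1)])
    then show ?case by (auto simp: GO.Obj_iff)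
  next
    case (step w w')
    then obtain h where h: "h \<in> Arr GO" "src GO h = i v" "rng GO h = i w" by blast
    have "\<exists>g \<in> Arr GO. src GO g = i w \<and> rng GO g = i w'"
      using step(2)
    proof
      assume "?E w w'"
      then obtain a where "a \<in> Arr Om" "rng Om a = w" "src Om a = w'" by blast
      then show ?thesis
        using i(1-3)[of a] GO.ginv[of "i a"] by (intro bexI[of _ "ginv GO (i a)"]) auto
    next
      assume "?E w' w"
      then obtain a where "a \<in> Arr Om" "rng Om a = w'" "src Om a = w" by blast
      then show ?thesis using i(1-3)[of a] by (intro bexI[of _ "i a"]) auto
    qed
    then obtain g where g: "g \<in> Arr GO" "src GO g = rng GO h" "rng GO g = i w'" using h by auto
    note * = g(1) h(1) g(2)
    show ?case
      using GO.cmp_closed[OF *] GO.src_cmp[OF *] GO.rng_cmp[OF *] h g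
      by (intro bexI[of _ "g \<cdot>\<^bsub>GO\<^esub> h"]) auto
  qed
  then show ?thesis using that by blast
qed

section \<open>Images of fundamental groups and their conjugacy\<close>

abbreviation fgroup :: "'l \<Rightarrow> 'h monoid" where
  "fgroup \<equiv> fundamental_group GL j"

lemma j_Obj: "x \<in> Obj L \<Longrightarrow> j x \<in> Obj GL"
  by (rule L.functor_Obj[OF j_functor])

lemma i_Obj: "v \<in> Obj Om \<Longrightarrow> i v \<in> Obj GO"
  by (rule Om.functor_Obj[OF i_functor])

lemma group_fgroup: "x \<in> Obj L \<Longrightarrow> group (fgroup x)"
  using group_fundamental_group[of GL j x] GL.groupoid_axioms j_Obj by simp

lemma pimage_eq: "pimage v = pstar ` {h \<in> Arr GO. rng GO h = i v \<and> src GO h = i v}"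
  by (simp add: induced_image_def)

lemma pstar_ends:
  assumes "h \<in> Arr GO" "v \<in> Obj Om"
  shows "src GO h = i v \<Longrightarrow> src GL (pstar h) = j (p v)"
    and "rng GO h = i v \<Longrightarrow> rng GL (pstar h) = j (p v)"
  using pstar(2,3)[OF assms(1)] pstar_Obj[OF assms(2)] by metis+

lemma subgroup_pimage:
  assumes v: "v \<in> Obj Om"
  shows "subgroup (pimage v) (fgroup (p v))"
proof (rule group.subgroupI[OF group_fgroup[OF p_Obj[OF v]]])
  have iv: "i v \<in> Arr GO" "src GO (i v) = i v" "rng GO (i v) = i v"
    using i_Obj[OF v] by (auto simp: GO.Obj_iff)
  show carrier: "pimage v \<subseteq> carrier (fgroup (p v))"
    using pstar(1) pstar_ends[OF _ v] by (auto simp: pimage_eq)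
  show "pimage v \<noteq> {}" using iv by (auto simp: pimage_eq)
  fix a assume a: "a \<in> pimage v"
  then obtain h where h: "h \<in> Arr GO" "rng GO h = i v" "src GO h = i v" "a = pstar h"
    by (auto simp: pimage_eq)
  have "inv\<^bsub>fgroup (p v)\<^esub> a = pstar (ginv GO h)"
    using inv_fundamental_group[of GL j "p v" a, OF GL.groupoid_axioms j_Obj[OF p_Obj[OF v]]] a carrier h
      pstar_ginv[OF h(1)] by auto
  then show "inv\<^bsub>fgroup (p v)\<^esub> a \<in> pimage v"
    using h GO.ginv[OF h(1)] by (auto simp: pimage_eq)
  fix b assume "b \<in> pimage v"
  then obtain g where g: "g \<in> Arr GO" "rng GO g = i v" "src GO g = i v" "b = pstar g"
    by (auto simp: pimage_eq)
  have hg: "src GO h = rng GO g" using h g by simp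
  have "a \<otimes>\<^bsub>fgroup (p v)\<^esub> b = pstar (h \<cdot>\<^bsub>GO\<^esub> g)"
    using pstar(4)[OF h(1) g(1) hg] h g by simp
  then show "a \<otimes>\<^bsub>fgroup (p v)\<^esub> b \<in> pimage v"
    using GO.cmp_closed[OF h(1) g(1) hg] GO.src_cmp[OF h(1) g(1) hg] GO.rng_cmp[OF h(1) g(1) hg] h g
    by (auto simp: pimage_eq)
qed

text \<open>As \<open>v\<close> and \<open>w\<close> both lie over \<open>x\<close>, the arrow
  \<open>h\<close> projects to a loop at \<open>x\<close>. The equation is the image under
  \<open>pstar\<close> of \<open>loops_conjugate\<close>.\<close>

lemma pimage_conjugate:
  assumes h: "h \<in> Arr GO" "src GO h = i v" "rng GO h = i w"
    and vw: "v \<in> Obj Om" "w \<in> Obj Om" "p v = x" "p w = x"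
  shows "pstar h \<in> carrier (fgroup x)"
    and "pimage w = (\<lambda>n. pstar h \<otimes>\<^bsub>fgroup x\<^esub> n \<otimes>\<^bsub>fgroup x\<^esub> inv\<^bsub>fgroup x\<^esub> (pstar h)) ` pimage v"
proof -
  show carrier: "pstar h \<in> carrier (fgroup x)"
    using pstar(1)[OF h(1)] pstar_ends[OF h(1)] h vw by simp
  have x: "x \<in> Obj L" using p_Obj vw by blast
  note inv = inv_fundamental_group[OF GL.groupoid_axioms j_Obj[OF x] carrier]
  note h' = GO.ginv[OF h(1)]
  \<comment> \<open>\<open>loops_conjugate\<close> brackets to the right and conjugation in the
    group to the left, so functoriality is followed by associativity.\<close>
  have conj: "pstar (h \<cdot>\<^bsub>GO\<^esub> (n \<cdot>\<^bsub>GO\<^esub> ginv GO h)) =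
      pstar h \<otimes>\<^bsub>fgroup x\<^esub> pstar n \<otimes>\<^bsub>fgroup x\<^esub> inv\<^bsub>fgroup x\<^esub> (pstar h)"
    if n: "n \<in> Arr GO" "rng GO n = src GO h" "src GO n = src GO h" for n
  proof -
    have nh: "src GO n = rng GO (ginv GO h)" using n h' by simp
    note c = GO.cmp_closed[OF n(1) h'(1) nh] GO.rng_cmp[OF n(1) h'(1) nh]
    have "pstar (h \<cdot>\<^bsub>GO\<^esub> (n \<cdot>\<^bsub>GO\<^esub> ginv GO h)) = pstar h \<cdot>\<^bsub>GL\<^esub> (pstar n \<cdot>\<^bsub>GL\<^esub> ginv GL (pstar h))"
      using pstar(4)[OF h(1) c(1)] pstar(4)[OF n(1) h'(1) nh] c(2) n pstar_ginv[OF h(1)] by simp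
    also have "\<dots> = (pstar h \<cdot>\<^bsub>GL\<^esub> pstar n) \<cdot>\<^bsub>GL\<^esub> ginv GL (pstar h)"
    proof (rule GL.cmp_assoc[symmetric])
      show "src GL (pstar h) = rng GL (pstar n)" "src GL (pstar n) = rng GL (ginv GL (pstar h))"
        using pstar(2)[OF h(1)] pstar(2,3)[OF n(1)] GL.ginv(3)[OF pstar(1)[OF h(1)]] n(2,3)
        by metis+
    qed (use GL.ginv(1) pstar(1) h(1) n(1) in auto)
    finally show ?thesis using inv by simp
  qed
  let ?N = "{n \<in> Arr GO. rng GO n = src GO h \<and> src GO n = src GO h}"
  have "pstar ` (\<lambda>n. h \<cdot>\<^bsub>GO\<^esub> (n \<cdot>\<^bsub>GO\<^esub> ginv GO h)) ` ?N =
    (\<lambda>n. pstar h \<otimes>\<^bsub>fgroup x\<^esub> n \<otimes>\<^bsub>fgroup x\<^esub> inv\<^bsub>fgroup x\<^esub> (pstar h)) ` pstar ` ?N"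
    unfolding image_image using conj by (intro image_cong) auto
  then show "pimage w = (\<lambda>n. pstar h \<otimes>\<^bsub>fgroup x\<^esub> n \<otimes>\<^bsub>fgroup x\<^esub> inv\<^bsub>fgroup x\<^esub> (pstar h)) ` pimage v"
    unfolding pimage_eq h(2,3)[symmetric] GO.loops_conjugate[OF h(1)] .
qed

text \<open>A conjugating loop lifts to an arrow from \<open>v\<close>; its end \<open>w\<close>
  again lies over \<open>x\<close> and has the conjugate as its image. Conversely, connectedness
  supplies an arrow from \<open>v\<close> to any \<open>w\<close> in the fibre, and its projection
  conjugates.\<close>

lemma conjugates_of_pimage:
  assumes v: "v \<in> Obj Om" "p v = x"
  shows "conjugate_subgroups (fgroup x) (pimage v) K \<longleftrightarrow> (\<exists>w \<in> Obj Om. p w = x \<and> K = pimage w)"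
proof
  assume "conjugate_subgroups (fgroup x) (pimage v) K"
  then obtain g where g: "g \<in> carrier (fgroup x)"
    "K = (\<lambda>n. g \<otimes>\<^bsub>fgroup x\<^esub> n \<otimes>\<^bsub>fgroup x\<^esub> inv\<^bsub>fgroup x\<^esub> g) ` pimage v"
    by (auto simp: conjugate_subgroups_def)
  have g': "g \<in> Arr GL" "src GL g = j (p v)" "rng GL g = j x" using g(1) v(2) by auto
  obtain h where h: "h \<in> Arr GO" "src GO h = i v" "pstar h = g"
    using lift_exists[OF g'(1) v(1) g'(2)] by blast
  obtain w where w: "w \<in> Obj Om" "i w = rng GO h" using i_surj GO.rng_Obj[OF h(1)] by metis
  have "j (p w) = j x" using pstar_ends(2)[OF h(1) w(1)] w(2) h(3) g'(3) by simp
  then have pw: "p w = x" using j_inj p_Obj w(1) v by blast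
  show "\<exists>w \<in> Obj Om. p w = x \<and> K = pimage w"
    using pimage_conjugate(2)[OF h(1,2) w(2)[symmetric] v(1) w(1) v(2) pw] w(1) pw g(2) h(3) by auto
next
  assume "\<exists>w \<in> Obj Om. p w = x \<and> K = pimage w"
  then obtain w where w: "w \<in> Obj Om" "p w = x" "K = pimage w" by blast
  obtain h where h: "h \<in> Arr GO" "src GO h = i v" "rng GO h = i w"
    using connecting_arrow[OF v(1) w(1)] .
  show "conjugate_subgroups (fgroup x) (pimage v) K"
    unfolding conjugate_subgroups_def
    using pimage_conjugate[OF h v(1) w(1) v(2) w(2)] subgroup_pimage[OF v(1)]
      subgroup_pimage[OF w(1)] v(2) w(2,3) by auto
qed

lemma conjugacy_class_pimages:
  assumes x: "x \<in> Obj L"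
  shows "conjugacy_class_of_subgroups (fgroup x) {pimage v | v. v \<in> Obj Om \<and> p v = x}"
proof -
  obtain v where v: "v \<in> Obj Om" "p v = x" using fibre_nonempty[OF x] .
  have "{pimage w | w. w \<in> Obj Om \<and> p w = x} = {K. conjugate_subgroups (fgroup x) (pimage v) K}"
    using conjugates_of_pimage[OF v] by blast
  then show ?thesis
    using subgroup_pimage[OF v(1)] v(2) unfolding conjugacy_class_of_subgroups_def by blast
qed

end

section \<open>Morphisms of coverings\<close>

lemma covering_morphism_id: "covering_morphism Om p Om p (\<lambda>a. a)"
  by (simp add: covering_morphism_def kgraph_morphism_def is_functor_def)

lemma covering_morphism_comp:
  assumes "covering_morphism A p B q \<phi>" "covering_morphism B q C r \<psi>"
  shows "covering_morphism A p C r (\<lambda>a. \<psi> (\<phi> a))"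
proof -
  have \<phi>: "is_functor A B \<phi>" "\<forall>a \<in> Arr A. deg B (\<phi> a) = deg A a" "\<forall>a \<in> Arr A. q (\<phi> a) = p a"
    and \<psi>: "is_functor B C \<psi>" "\<forall>a \<in> Arr B. deg C (\<psi> a) = deg B a" "\<forall>a \<in> Arr B. r (\<psi> a) = q a"
    using assms by (auto simp: covering_morphism_def kgraph_morphism_def)
  then show ?thesis
    using is_functor_comp[OF \<phi>(1) \<psi>(1)] is_functorD(1)[OF \<phi>(1)]
    by (simp add: covering_morphism_def kgraph_morphism_def)
qed

text \<open>The two instances share \<open>GL\<close> and \<open>j\<close>, so that both images are
  subgroups of the same group.\<close>

locale fundamental_coverings =
  A: fundamental_covering k L Om p GL j GO i + B: fundamental_covering k L Si q GL j GS l
  for k :: nat and L :: "('l, 'y) kgraph_scheme" and Om :: "('o, 'z) kgraph_scheme"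
    and p :: "'o \<Rightarrow> 'l" and GL :: "'h cat" and j :: "'l \<Rightarrow> 'h" and GO :: "'g cat" and i :: "'o \<Rightarrow> 'g"
    and Si :: "('s, 'x) kgraph_scheme" and q :: "'s \<Rightarrow> 'l" and GS :: "'gs cat" and l :: "'s \<Rightarrow> 'gs"
begin

context
  fixes \<phi>
  assumes \<phi>: "covering_morphism Om p Si q \<phi>"
begin

lemma morphism_functor: "is_functor Om Si \<phi>"
  using \<phi> by (simp add: covering_morphism_def kgraph_morphism_def)

lemma q_morphism: "a \<in> Arr Om \<Longrightarrow> q (\<phi> a) = p a"
  using \<phi> by (simp add: covering_morphism_def)

lemma morphism_Obj: "v \<in> Obj Om \<Longrightarrow> \<phi> v \<in> Obj Si"
  by (rule A.Om.functor_Obj[OF morphism_functor])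

abbreviation "morphism_star \<equiv> induced Om GO i GS l \<phi>"

lemma morphism_star_functor: "is_functor GO GS morphism_star"
  and morphism_star_incl: "a \<in> Arr Om \<Longrightarrow> morphism_star (i a) = l (\<phi> a)"
  using induced_functor[OF A.Om.category_axioms morphism_functor A.fundamental_Om B.fundamental_Om]
  by blast+

text \<open>Both functors send \<open>i a\<close> to \<open>j (p a)\<close>, because
  \<open>q\<close> after \<open>\<phi>\<close> is \<open>p\<close>; uniqueness in the universal
  property of \<open>GO\<close> does the rest.\<close>

lemma pstar_morphism_star:
  assumes "h \<in> Arr GO"
  shows "B.pstar (morphism_star h) = A.pstar h"
proof (rule universal_at_unique[OF _ A.GL.groupoid_axioms A.GO.category_axioms A.i_functor])
  show "universal_at TYPE('h) Om GO i"
    by (rule fundamental_groupoid_universal[OF A.Om.category_axioms A.fundamental_Om])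
  show "is_functor GO GL (\<lambda>h. B.pstar (morphism_star h))"
    by (rule is_functor_comp[OF morphism_star_functor B.pstar_functor])
  show "is_functor GO GL A.pstar" by (rule A.pstar_functor)
  show "B.pstar (morphism_star (i a)) = A.pstar (i a)" if "a \<in> Arr Om" for a
    using that is_functorD(1)[OF morphism_functor that]
    by (simp add: morphism_star_incl B.pstar_incl A.pstar_incl q_morphism)
qed fact

lemma morphism_star_ends:
  assumes "h \<in> Arr GO" "v \<in> Obj Om"
  shows "src GO h = i v \<Longrightarrow> src GS (morphism_star h) = l (\<phi> v)"
    and "rng GO h = i v \<Longrightarrow> rng GS (morphism_star h) = l (\<phi> v)"
proof -
  have "morphism_star (i v) = l (\<phi> v)" using morphism_star_incl assms(2) by (simp add: Obj_def)
  then show "src GO h = i v \<Longrightarrow> src GS (morphism_star h) = l (\<phi> v)"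
    and "rng GO h = i v \<Longrightarrow> rng GS (morphism_star h) = l (\<phi> v)"
    using is_functorD(2,3)[OF morphism_star_functor assms(1)] by metis+
qed

text \<open>Necessity in (2): \<open>morphism_star\<close> carries a loop at \<open>v\<close> to a
  loop at \<open>\<phi> v\<close> with the same projection.\<close>

lemma pimage_morphism_subset:
  assumes v: "v \<in> Obj Om"
  shows "A.pimage v \<subseteq> B.pimage (\<phi> v)"
proof
  fix g assume "g \<in> A.pimage v"
  then obtain h where h: "h \<in> Arr GO" "rng GO h = i v" "src GO h = i v" "g = A.pstar h"
    by (auto simp: A.pimage_eq)
  then show "g \<in> B.pimage (\<phi> v)"
    using pstar_morphism_star[OF h(1)] is_functorD(1)[OF morphism_star_functor h(1)]
      morphism_star_ends[OF h(1) v] by (auto simp: B.pimage_eq intro!: image_eqI[of _ _ "morphism_star h"])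
qed

end

text \<open>For an arrow \<open>h\<close> of \<open>GO\<close> from \<open>v\<close> to
  \<open>w\<close>, its images under the two induced functors lift \<open>A.pstar h\<close> from the
  same object, hence end at the same object. This settles vertices; arrows then agree as lifts with
  equal source.\<close>

lemma morphism_unique:
  assumes \<phi>: "covering_morphism Om p Si q \<phi>" and \<psi>: "covering_morphism Om p Si q \<psi>"
    and v: "v \<in> Obj Om" "\<phi> v = \<psi> v" and a: "a \<in> Arr Om"
  shows "\<phi> a = \<psi> a"
proof -
  have Obj: "\<phi> w = \<psi> w" if w: "w \<in> Obj Om" for w
  proof -
    obtain h where h: "h \<in> Arr GO" "src GO h = i v" "rng GO h = i w"
      using A.connecting_arrow[OF v(1) w] .
    have "rng GS (induced Om GO i GS l \<phi> h) = rng GS (induced Om GO i GS l \<psi> h)"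
      using is_functorD(1)[OF morphism_star_functor[OF \<phi>] h(1)]
        is_functorD(1)[OF morphism_star_functor[OF \<psi>] h(1)]
        morphism_star_ends(1)[OF \<phi> h(1) v(1) h(2)] morphism_star_ends(1)[OF \<psi> h(1) v(1) h(2)] v(2)
        pstar_morphism_star[OF \<phi> h(1)] pstar_morphism_star[OF \<psi> h(1)]
      by (intro B.range_lift_unique) simp_all
    then have "l (\<phi> w) = l (\<psi> w)"
      using morphism_star_ends(2)[OF \<phi> h(1) w h(3)] morphism_star_ends(2)[OF \<psi> h(1) w h(3)] by simp
    then show ?thesis using B.i_inj morphism_Obj[OF \<phi> w] morphism_Obj[OF \<psi> w] by blast
  qed
  note F = is_functorD[OF morphism_functor[OF \<phi>]] and G = is_functorD[OF morphism_functor[OF \<psi>]]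
  show ?thesis
  proof (rule B.lift_unique)
    show "\<phi> a \<in> Arr Si" "\<psi> a \<in> Arr Si" using F(1) G(1) a by blast+
    show "q (\<phi> a) = q (\<psi> a)" using q_morphism[OF \<phi> a] q_morphism[OF \<psi> a] by simp
    show "src Si (\<phi> a) = src Si (\<psi> a)"
      using F(2)[OF a] G(2)[OF a] Obj[OF A.Om.src_Obj[OF a]] by simp
  qed
qed

section \<open>Existence of morphisms\<close>

text \<open>The morphism is obtained by carrying a vertex \<open>w\<close> along a class \<open>h\<close> of paths from \<open>v\<close> to \<open>w\<close> to
  the end of the lift to \<open>Si\<close>, starting at \<open>u\<close>, of the projection of \<open>h\<close>; the inclusion of the
  subgroups makes the result independent of \<open>h\<close>.\<close>

lemma morphism_exists:
  assumes v: "v \<in> Obj Om" and u: "u \<in> Obj Si" and vu: "p v = q u"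
    and sub: "A.pimage v \<subseteq> B.pimage u"
  shows "\<exists>\<phi>. covering_morphism Om p Si q \<phi> \<and> \<phi> v = u"
proof -
  \<comment> \<open>\<open>E\<close> is going to be the graph of the morphism on vertices.\<close>
  define E where "E w t \<longleftrightarrow> w \<in> Obj Om \<and> t \<in> Obj Si \<and> (\<exists>h \<in> Arr GO. \<exists>g \<in> Arr GS.
      src GO h = i v \<and> rng GO h = i w \<and> src GS g = l u \<and> rng GS g = l t \<and> A.pstar h = B.pstar g)"
    for w t
  have E_fun: "t = t'" if "E w t" "E w t'" for w t t'
  proof -
    from that(1) obtain h g where h: "h \<in> Arr GO" "src GO h = i v" "rng GO h = i w"
      and g: "g \<in> Arr GS" "src GS g = l u" "rng GS g = l t" and hg: "A.pstar h = B.pstar g"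
      and t: "t \<in> Obj Si" unfolding E_def by blast
    from that(2) obtain h' g' where h': "h' \<in> Arr GO" "src GO h' = i v" "rng GO h' = i w"
      and g': "g' \<in> Arr GS" "src GS g' = l u" "rng GS g' = l t'" and hg': "A.pstar h' = B.pstar g'"
      and t': "t' \<in> Obj Si" unfolding E_def by blast
    \<comment> \<open>\<open>n\<close> is the loop at \<open>v\<close> by which \<open>h'\<close>
      differs from \<open>h\<close>. By \<open>sub\<close> it has the projection of a loop
      \<open>m\<close> at \<open>u\<close>. Then \<open>g'\<close> and the composite of
      \<open>g\<close> and \<open>m\<close> share source and projection, hence range, and the
      composite ends where \<open>g\<close> does.\<close>
    define n where "n = ginv GO h \<cdot>\<^bsub>GO\<^esub> h'"
    note gh = A.GO.ginv[OF h(1)]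
    have c: "src GO (ginv GO h) = rng GO h'" using gh h h' by simp
    have n: "n \<in> Arr GO" "rng GO n = i v" "src GO n = i v"
      unfolding n_def using A.GO.cmp_closed[OF gh(1) h'(1) c] A.GO.rng_cmp[OF gh(1) h'(1) c]
        A.GO.src_cmp[OF gh(1) h'(1) c] gh h h' by simp_all
    have hn: "h \<cdot>\<^bsub>GO\<^esub> n = h'" unfolding n_def using A.GO.cancel_left'[OF h(1) h'(1)] h h' by simp
    have "A.pstar n \<in> B.pimage u" using sub n by (auto simp: A.pimage_eq)
    then obtain m where m: "m \<in> Arr GS" "rng GS m = l u" "src GS m = l u" "A.pstar n = B.pstar m"
      by (auto simp: B.pimage_eq)
    have gm: "src GS g = rng GS m" using g m by simp
    have "B.pstar g' = B.pstar (g \<cdot>\<^bsub>GS\<^esub> m)"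
      using B.pstar(4)[OF g(1) m(1) gm] A.pstar(4)[OF h(1) n(1)] hn h n hg hg' m(4) by simp
    then have "rng GS g' = rng GS (g \<cdot>\<^bsub>GS\<^esub> m)"
      using B.GO.cmp_closed[OF g(1) m(1) gm] B.GO.src_cmp[OF g(1) m(1) gm] g' m
      by (intro B.range_lift_unique) simp_all
    then have "l t = l t'" using B.GO.rng_cmp[OF g(1) m(1) gm] g g' by simp
    then show ?thesis by (rule B.i_inj[OF t t'])
  qed
  have E_ex: "\<exists>t. E w t" if w: "w \<in> Obj Om" for w
  proof -
    obtain h where h: "h \<in> Arr GO" "src GO h = i v" "rng GO h = i w"
      using A.connecting_arrow[OF v w] .
    have "src GL (A.pstar h) = j (q u)" using A.pstar_ends(1)[OF h(1) v h(2)] vu by simp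
    then obtain g where g: "g \<in> Arr GS" "src GS g = l u" "B.pstar g = A.pstar h"
      using B.lift_exists[OF A.pstar(1)[OF h(1)] u] by blast
    obtain t where t: "t \<in> Obj Si" "l t = rng GS g" using B.i_surj B.GO.rng_Obj[OF g(1)] by metis
    have "E w t" unfolding E_def using w t h g by metis
    then show ?thesis by blast
  qed
  have E_over: "q t = p w" if "E w t" for w t
  proof -
    from that obtain h g where h: "h \<in> Arr GO" "rng GO h = i w"
      and g: "g \<in> Arr GS" "rng GS g = l t" and hg: "A.pstar h = B.pstar g"
      and wt: "w \<in> Obj Om" "t \<in> Obj Si" unfolding E_def by blast
    have "j (q t) = j (p w)"
      using A.pstar_ends(2)[OF h(1) wt(1) h(2)] B.pstar_ends(2)[OF g(1) wt(2) g(2)] hg by simp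
    then show ?thesis by (rule A.j_inj[OF B.p_Obj[OF wt(2)] A.p_Obj[OF wt(1)]])
  qed
  \<comment> \<open>\<open>E\<close> persists along arrows with equal projections: prolong
    \<open>h\<close> by \<open>i a\<close> and \<open>g\<close> by \<open>l b\<close>.\<close>
  have E_step: "E (rng Om a) (rng Si b)"
    if a: "a \<in> Arr Om" and b: "b \<in> Arr Si" and ab: "p a = q b" "E (src Om a) (src Si b)" for a b
  proof -
    from ab(2) obtain h g where h: "h \<in> Arr GO" "src GO h = i v" "rng GO h = i (src Om a)"
      and g: "g \<in> Arr GS" "src GS g = l u" "rng GS g = l (src Si b)" and hg: "A.pstar h = B.pstar g"
      unfolding E_def by blast
    have ah: "src GO (i a) = rng GO h" and bg: "src GS (l b) = rng GS g"
      using A.i(2)[OF a] B.i(2)[OF b] h g by simp_all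
    note * = A.i(1)[OF a] h(1) ah and ** = B.i(1)[OF b] g(1) bg
    have "A.pstar (i a \<cdot>\<^bsub>GO\<^esub> h) = B.pstar (l b \<cdot>\<^bsub>GS\<^esub> g)"
      using A.pstar(4)[OF *] B.pstar(4)[OF **] A.pstar_incl[OF a] B.pstar_incl[OF b] ab(1) hg by simp
    then show ?thesis
      unfolding E_def
      using A.Om.rng_Obj[OF a] B.Om.rng_Obj[OF b] A.GO.cmp_closed[OF *] B.GO.cmp_closed[OF **]
        A.GO.src_cmp[OF *] A.GO.rng_cmp[OF *] B.GO.src_cmp[OF **] B.GO.rng_cmp[OF **]
        A.i(3)[OF a] B.i(3)[OF b] h(2) g(2)
      by (intro conjI bexI[of _ "i a \<cdot>\<^bsub>GO\<^esub> h"] bexI[of _ "l b \<cdot>\<^bsub>GS\<^esub> g"]) simp_all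
  qed
  have ex: "\<exists>b. b \<in> Arr Si \<and> q b = p a \<and> E (src Om a) (src Si b)" if a: "a \<in> Arr Om" for a
  proof -
    obtain t where t: "E (src Om a) t" using E_ex[OF A.Om.src_Obj[OF a]] by blast
    then have tS: "t \<in> Obj Si" by (simp add: E_def)
    have "src L (p a) = q t" using A.p(2)[OF a] E_over[OF t] by simp
    then obtain b where "b \<in> Arr Si" "src Si b = t" "q b = p a"
      using B.lift_from_source[OF tS A.p(1)[OF a]] by metis
    with t show ?thesis by blast
  qed
  \<comment> \<open>The value at \<open>a\<close> is the lift of \<open>p a\<close> that starts at
    the vertex assigned by \<open>E\<close> to the source of \<open>a\<close>.\<close>
  define \<phi> where "\<phi> a = (SOME b. b \<in> Arr Si \<and> q b = p a \<and> E (src Om a) (src Si b))" for a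
  have \<phi>: "\<phi> a \<in> Arr Si" "q (\<phi> a) = p a" "E (src Om a) (src Si (\<phi> a))" if "a \<in> Arr Om" for a
    using someI_ex[OF ex[OF that]] by (auto simp: \<phi>_def)
  \<comment> \<open>The choice has only one candidate: \<open>E_fun\<close> fixes the source and
    \<open>lift_unique\<close> then the arrow. The functor laws below are obtained by checking
    candidates.\<close>
  have \<phi>_eq: "\<phi> a = b" if "a \<in> Arr Om" "b \<in> Arr Si" "q b = p a" "E (src Om a) (src Si b)" for a b
    using B.lift_unique[OF \<phi>(1)[OF that(1)] that(2)] \<phi>(2)[OF that(1)] that(3)
      E_fun[OF \<phi>(3)[OF that(1)] that(4)] by simp
  have \<phi>_Obj: "\<phi> w = t" if "E w t" for w t
  proof (rule \<phi>_eq)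
    have wt: "w \<in> Obj Om" "t \<in> Obj Si" using that by (auto simp: E_def)
    then show "w \<in> Arr Om" "t \<in> Arr Si" "E (src Om w) (src Si t)" using that by (auto simp: Obj_def)
    show "q t = p w" by (rule E_over[OF that])
  qed
  have \<phi>_src: "src Si (\<phi> a) = \<phi> (src Om a)" if "a \<in> Arr Om" for a
    using \<phi>_Obj[OF \<phi>(3)[OF that]] by simp
  have E_rng: "E (rng Om a) (rng Si (\<phi> a))" if "a \<in> Arr Om" for a
    by (rule E_step[OF that \<phi>(1)[OF that] \<phi>(2)[OF that, symmetric] \<phi>(3)[OF that]])
  have \<phi>_rng: "rng Si (\<phi> a) = \<phi> (rng Om a)" if "a \<in> Arr Om" for a
    using \<phi>_Obj[OF E_rng[OF that]] by simp
  have \<phi>_cmp: "\<phi> (a \<cdot>\<^bsub>Om\<^esub> b) = \<phi> a \<cdot>\<^bsub>Si\<^esub> \<phi> b" if ab: "a \<in> Arr Om" "b \<in> Arr Om" "src Om a = rng Om b" for a b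
  proof (rule \<phi>_eq)
    have c: "src Si (\<phi> a) = rng Si (\<phi> b)" using ab \<phi>_src \<phi>_rng by metis
    note * = \<phi>(1)[OF ab(1)] \<phi>(1)[OF ab(2)] c
    show "a \<cdot>\<^bsub>Om\<^esub> b \<in> Arr Om" by (rule A.Om.cmp_closed[OF ab])
    show "\<phi> a \<cdot>\<^bsub>Si\<^esub> \<phi> b \<in> Arr Si" by (rule B.Om.cmp_closed[OF *])
    show "q (\<phi> a \<cdot>\<^bsub>Si\<^esub> \<phi> b) = p (a \<cdot>\<^bsub>Om\<^esub> b)"
      using B.p(4)[OF *] A.p(4)[OF ab] \<phi>(2) ab by simp
    show "E (src Om (a \<cdot>\<^bsub>Om\<^esub> b)) (src Si (\<phi> a \<cdot>\<^bsub>Si\<^esub> \<phi> b))"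
      using B.Om.src_cmp[OF *] A.Om.src_cmp[OF ab] \<phi>(3)[OF ab(2)] by simp
  qed
  \<comment> \<open>Both degrees equal that of \<open>p a\<close>, since the projections preserve
    degree.\<close>
  have deg: "deg Si (\<phi> a) = deg Om a" if "a \<in> Arr Om" for a
    using B.deg_p[OF \<phi>(1)[OF that]] A.deg_p[OF that] \<phi>(2)[OF that] by simp
  have "covering_morphism Om p Si q \<phi>"
    using \<phi> \<phi>_src \<phi>_rng \<phi>_cmp deg
    by (simp add: covering_morphism_def kgraph_morphism_def is_functor_def)
  moreover have "E v u"
  proof -
    have iv: "i v \<in> Arr GO" "src GO (i v) = i v" "rng GO (i v) = i v"
      using A.i_Obj[OF v] by (auto simp: A.GO.Obj_iff)
    have lu: "l u \<in> Arr GS" "src GS (l u) = l u" "rng GS (l u) = l u"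
      using B.i_Obj[OF u] by (auto simp: B.GO.Obj_iff)
    have "A.pstar (i v) = B.pstar (l u)" using A.pstar_Obj[OF v] B.pstar_Obj[OF u] vu by simp
    then show ?thesis unfolding E_def using v u iv lu by blast
  qed
  ultimately show ?thesis using \<phi>_Obj by blast
qed

section \<open>The criteria for morphisms and isomorphisms\<close>

lemma morphism_iff:
  assumes "v \<in> fibre Om p x" "u \<in> fibre Si q x"
  shows "(\<exists>\<phi>. covering_morphism Om p Si q \<phi> \<and> \<phi> v = u) \<longleftrightarrow> A.pimage v \<subseteq> B.pimage u"
  using assms morphism_exists[of v u] pimage_morphism_subset[of _ v] by (auto simp: fibre_def)

text \<open>Inclusions along \<open>\<phi>\<close> and along its inverse show that the images at
  \<open>v\<close> and at \<open>\<phi> v\<close> are equal. Now \<open>\<phi> v\<close> and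
  \<open>u\<close> lie in one fibre of \<open>q\<close>, so part (1) for \<open>Si\<close> gives
  conjugacy.\<close>

lemma conjugate_of_isomorphic:
  assumes iso: "coverings_isomorphic Om p Si q"
    and v: "v \<in> fibre Om p x" and u: "u \<in> fibre Si q x"
  shows "conjugate_subgroups (A.fgroup x) (A.pimage v) (B.pimage u)"
proof -
  interpret BA: fundamental_coverings k L Si q GL j GS l Om p GO i ..
  obtain \<phi> \<psi> where \<phi>: "covering_morphism Om p Si q \<phi>" and \<psi>: "covering_morphism Si q Om p \<psi>"
    and inv: "\<And>a. a \<in> Arr Om \<Longrightarrow> \<psi> (\<phi> a) = a"
    using iso by (auto simp: coverings_isomorphic_def)
  have v': "v \<in> Obj Om" "v \<in> Arr Om" "p v = x" and u': "u \<in> Obj Si" "q u = x"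
    using v u by (auto simp: fibre_def Obj_def)
  have w: "\<phi> v \<in> Obj Si" "q (\<phi> v) = x"
    using morphism_Obj[OF \<phi> v'(1)] q_morphism[OF \<phi> v'(2)] v'(3) by simp_all
  have "A.pimage v = B.pimage (\<phi> v)"
    using pimage_morphism_subset[OF \<phi> v'(1)] BA.pimage_morphism_subset[OF \<psi> w(1)] inv[OF v'(2)]
    by simp
  then show ?thesis using B.conjugates_of_pimage[OF w] u' by auto
qed

text \<open>By (1) the image at \<open>u\<close> equals the image at some \<open>w\<close> in the
  fibre of \<open>p\<close>. Equality gives morphisms in both directions exchanging \<open>w\<close>
  and \<open>u\<close>; their composites fix a vertex, so they are identities.\<close>

lemma isomorphic_of_conjugate:
  assumes v: "v \<in> fibre Om p x" and u: "u \<in> fibre Si q x"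
    and conj: "conjugate_subgroups (A.fgroup x) (A.pimage v) (B.pimage u)"
  shows "coverings_isomorphic Om p Si q"
proof -
  interpret BA: fundamental_coverings k L Si q GL j GS l Om p GO i ..
  \<comment> \<open>Each covering is paired with itself in order to compare an endomorphism fixing a
    vertex with the identity.\<close>
  interpret AA: fundamental_coverings k L Om p GL j GO i Om p GO i ..
  interpret BB: fundamental_coverings k L Si q GL j GS l Si q GS l ..
  have v': "v \<in> Obj Om" "p v = x" and u': "u \<in> Obj Si" "q u = x"
    using v u by (auto simp: fibre_def)
  obtain w where w: "w \<in> Obj Om" "p w = x" "B.pimage u = A.pimage w"
    using conj A.conjugates_of_pimage[OF v'] by blast
  obtain \<phi> where \<phi>: "covering_morphism Om p Si q \<phi>" "\<phi> w = u"
    using morphism_exists[OF w(1) u'(1)] w u' by auto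
  obtain \<psi> where \<psi>: "covering_morphism Si q Om p \<psi>" "\<psi> u = w"
    using BA.morphism_exists[OF u'(1) w(1)] w u' by auto
  have "\<psi> (\<phi> a) = a" if "a \<in> Arr Om" for a
    by (rule AA.morphism_unique[OF covering_morphism_comp[OF \<phi>(1) \<psi>(1)] covering_morphism_id w(1)])
      (use \<phi>(2) \<psi>(2) that in auto)
  moreover have "\<phi> (\<psi> b) = b" if "b \<in> Arr Si" for b
    by (rule BB.morphism_unique[OF covering_morphism_comp[OF \<psi>(1) \<phi>(1)] covering_morphism_id u'(1)])
      (use \<phi>(2) \<psi>(2) that in auto)
  ultimately show ?thesis using \<phi>(1) \<psi>(1) unfolding coverings_isomorphic_def by blast
qed

end

theorem theorem2p2:
  fixes k :: nat
    and \<Lambda> :: "'l kgraph" and \<Omega> :: "'o kgraph" and \<Sigma> :: "'s kgraph"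
    and p :: "'o \<Rightarrow> 'l" and q :: "'s \<Rightarrow> 'l"
    and G\<Lambda> :: "'gl cat" and i\<Lambda> :: "'l \<Rightarrow> 'gl"
    and G\<Omega> :: "'go cat" and i\<Omega> :: "'o \<Rightarrow> 'go"
    and G\<Sigma> :: "'gs cat" and i\<Sigma> :: "'s \<Rightarrow> 'gs"
  assumes "kgraph k \<Lambda>"
    and "connected_covering k \<Lambda> \<Omega> p"
    and "connected_covering k \<Lambda> \<Sigma> q"
    and "fundamental_groupoid \<Lambda> G\<Lambda> i\<Lambda>"
    and "fundamental_groupoid \<Omega> G\<Omega> i\<Omega>"
    and "fundamental_groupoid \<Sigma> G\<Sigma> i\<Sigma>"
  shows
    "(\<forall>x \<in> Obj \<Lambda>. conjugacy_class_of_subgroups (fundamental_group G\<Lambda> i\<Lambda> x)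
        {induced_image \<Omega> G\<Omega> i\<Omega> G\<Lambda> i\<Lambda> p v | v. v \<in> Obj \<Omega> \<and> p v = x})
     \<and> (\<forall>x \<in> Obj \<Lambda>. \<forall>v \<in> fibre \<Omega> p x. \<forall>u \<in> fibre \<Sigma> q x.
        (\<exists>\<phi>. covering_morphism \<Omega> p \<Sigma> q \<phi> \<and> \<phi> v = u) \<longleftrightarrow>
        induced_image \<Omega> G\<Omega> i\<Omega> G\<Lambda> i\<Lambda> p v \<subseteq> induced_image \<Sigma> G\<Sigma> i\<Sigma> G\<Lambda> i\<Lambda> q u)
     \<and> (coverings_isomorphic \<Omega> p \<Sigma> q \<longleftrightarrow>
        (\<exists>x \<in> Obj \<Lambda>. \<exists>v \<in> fibre \<Omega> p x. \<exists>u \<in> fibre \<Sigma> q x.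
          conjugate_subgroups (fundamental_group G\<Lambda> i\<Lambda> x)
            (induced_image \<Omega> G\<Omega> i\<Omega> G\<Lambda> i\<Lambda> p v) (induced_image \<Sigma> G\<Sigma> i\<Sigma> G\<Lambda> i\<Lambda> q u)))
     \<and> (coverings_isomorphic \<Omega> p \<Sigma> q \<longleftrightarrow>
        (\<forall>x \<in> Obj \<Lambda>. \<forall>v \<in> fibre \<Omega> p x. \<forall>u \<in> fibre \<Sigma> q x.
          conjugate_subgroups (fundamental_group G\<Lambda> i\<Lambda> x)
            (induced_image \<Omega> G\<Omega> i\<Omega> G\<Lambda> i\<Lambda> p v) (induced_image \<Sigma> G\<Sigma> i\<Sigma> G\<Lambda> i\<Lambda> q u)))"
proof -
  interpret fundamental_coverings k \<Lambda> \<Omega> p G\<Lambda> i\<Lambda> G\<Omega> i\<Omega> \<Sigma> q G\<Sigma> i\<Sigma>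
    using assms by (simp add: fundamental_coverings_def fundamental_covering_def)
  \<comment> \<open>This keeps the universal form of (3) from being vacuous: it supplies a triple at
    which conjugacy can be read off, and turns "every" into "some".\<close>
  have ex: "\<exists>x \<in> Obj \<Lambda>. \<exists>v \<in> fibre \<Omega> p x. \<exists>u \<in> fibre \<Sigma> q x. True"
  proof -
    obtain a where "a \<in> Arr \<Lambda>" using A.L.nonempty by blast
    then have x: "src \<Lambda> a \<in> Obj \<Lambda>" by (rule A.L.src_Obj)
    obtain v u where "v \<in> Obj \<Omega>" "p v = src \<Lambda> a" "u \<in> Obj \<Sigma>" "q u = src \<Lambda> a"
      using A.fibre_nonempty[OF x] B.fibre_nonempty[OF x] by metis
    then show ?thesis using x by (auto simp: fibre_def)
  qed
  show ?thesis
  proof (intro conjI ballI)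
    fix x v u assume "v \<in> fibre \<Omega> p x" "u \<in> fibre \<Sigma> q x"
    then show "(\<exists>\<phi>. covering_morphism \<Omega> p \<Sigma> q \<phi> \<and> \<phi> v = u) \<longleftrightarrow> A.pimage v \<subseteq> B.pimage u"
      by (rule morphism_iff)
  qed (use A.conjugacy_class_pimages ex conjugate_of_isomorphic isomorphic_of_conjugate in meson)+
qed

end
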